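(* For every constant $c_0$ there exists a positive integer $N_0(c_0)$, depending only on $c_0$, such that for every integer $n\ge N_0(c_0)$ and every unit vector $A=(a_1,\ldots,a_n)\in\mathbb{R}^n$ (so $\sum_{j=1}^n a_j^2=1$) with $0<a_1\le a_2\le\cdots\le a_n$ and $a_n/a_1<c_0$, one has $$\varphi_A(0)\cdot E\left(\left|\sum_{k=1}^n a_k\varepsilon_k\right|\right)\ \ge\ 1.$$
   Context: For a unit vector $A=(a_1,\ldots,a_n)\in\mathbb{R}^n$, let $H=\langle A\rangle^{\perp}$ be the hyperplane through the origin orthogonal to $A$, let $Q_n=[-\tfrac12,\tfrac12]^n$, and for $r\in\mathbb{R}$ set $\varphi_A(r)=\mathrm{vol}\big((H+rA)\cap Q_n\big)$, where $\mathrm{vol}$ denotes $(n-1)$-dimensional volume within the affine hyperplane $H+rA$. In particular $\varphi_A(0)$ is the $(n-1)$-dimensional volume of the central section $H\cap Q_n$. The $\varepsilon_k$ are mutually independent random variables with $P\{\varepsilon_k=1\}=P\{\varepsilon_k=-1\}=1/2$, and $E$ denotes expectation. *)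

theory Defs
  imports "HOL-Probability.Probability"
begin

text \<open>
  The dimension \<open>n\<close> is quantified inside the statement, so a vector of \<open>n\<close>-dimensional
  Euclidean space is a function on \<open>{1..n}\<close>, extended by \<open>undefined\<close>. This is the
  carrier of the library's product measure \<open>PiM {1..n} (\<lambda>_. lborel)\<close>, which is
  Lebesgue measure on that space.
\<close>

definition euclid :: "nat \<Rightarrow> (nat \<Rightarrow> real) set" where
  "euclid n = {1..n} \<rightarrow>\<^sub>E UNIV"

definition dotp :: "nat \<Rightarrow> (nat \<Rightarrow> real) \<Rightarrow> (nat \<Rightarrow> real) \<Rightarrow> real" where
  "dotp n x y = (\<Sum>i=1..n. x i * y i)"

definition hyperplane :: "nat \<Rightarrow> (nat \<Rightarrow> real) \<Rightarrow> (nat \<Rightarrow> real) set" where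
  "hyperplane n a = {x \<in> euclid n. dotp n a x = 0}"

definition shifted_hyperplane :: "nat \<Rightarrow> (nat \<Rightarrow> real) \<Rightarrow> real \<Rightarrow> (nat \<Rightarrow> real) set" where
  "shifted_hyperplane n a r = (\<lambda>h. \<lambda>i\<in>{1..n}. h i + r * a i) ` hyperplane n a"

definition cube :: "nat \<Rightarrow> (nat \<Rightarrow> real) set" where
  "cube n = {1..n} \<rightarrow>\<^sub>E {-1/2..1/2}"

text \<open>
  For \<open>a \<noteq> 0\<close> the hyperplane has dimension \<open>n - 1\<close>, so \<open>n - 1\<close> orthonormal vectors in it
  form an orthonormal basis.
\<close>

definition orthonormal_basis :: "nat \<Rightarrow> (nat \<Rightarrow> real) \<Rightarrow> (nat \<Rightarrow> nat \<Rightarrow> real) \<Rightarrow> bool" where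
  "orthonormal_basis n a u \<longleftrightarrow>
     (\<forall>j\<in>{1..n-1}. u j \<in> hyperplane n a) \<and>
     (\<forall>j\<in>{1..n-1}. \<forall>k\<in>{1..n-1}. dotp n (u j) (u k) = (if j = k then 1 else 0))"

text \<open>
  If \<open>u\<close> is such a basis, \<open>chart n a r u\<close> is an isometry from \<open>(n-1)\<close>-dimensional Euclidean
  space onto the affine hyperplane through \<open>r a\<close>. The \<open>(n-1)\<close>-dimensional volume within that
  hyperplane is Lebesgue measure transported along it. Different bases give charts that
  differ by an orthogonal map of the parameter space, which preserves Lebesgue measure, so
  the choice made by \<open>SOME\<close> does not matter; \<open>ex_orthonormal_basis\<close> below shows that there
  is something to choose.
\<close>

definition chart ::
  "nat \<Rightarrow> (nat \<Rightarrow> real) \<Rightarrow> real \<Rightarrow> (nat \<Rightarrow> nat \<Rightarrow> real) \<Rightarrow> (nat \<Rightarrow> real) \<Rightarrow> (nat \<Rightarrow> real)" where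
  "chart n a r u t = (\<lambda>i\<in>{1..n}. r * a i + (\<Sum>j=1..n-1. t j * u j i))"

definition hyperplane_vol ::
  "nat \<Rightarrow> (nat \<Rightarrow> real) \<Rightarrow> real \<Rightarrow> (nat \<Rightarrow> real) set \<Rightarrow> real" where
  "hyperplane_vol n a r S =
     (let u = (SOME u. orthonormal_basis n a u)
      in measure (PiM {1..n-1} (\<lambda>_. lborel)) {t \<in> euclid (n-1). chart n a r u t \<in> S})"

definition section_vol :: "nat \<Rightarrow> (nat \<Rightarrow> real) \<Rightarrow> real \<Rightarrow> real" where
  "section_vol n a r = hyperplane_vol n a r (shifted_hyperplane n a r \<inter> cube n)"

definition signs_pmf :: "nat \<Rightarrow> (nat \<Rightarrow> real) pmf" where
  "signs_pmf n = Pi_pmf {1..n} 0 (\<lambda>_. pmf_of_set {-1, 1})"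

definition sign_sum_mean :: "nat \<Rightarrow> (nat \<Rightarrow> real) \<Rightarrow> real" where
  "sign_sum_mean n a = measure_pmf.expectation (signs_pmf n) (\<lambda>e. \<bar>\<Sum>k=1..n. a k * e k\<bar>)"

text \<open>
  The Householder reflection exchanging \<open>a\<close> and a multiple of the last unit vector maps
  the other unit vectors to an orthonormal basis of the hyperplane.
\<close>

lemma ex_orthonormal_basis:
  assumes unit: "(\<Sum>j=1..n. (a j)\<^sup>2) = 1"
  shows "\<exists>u. orthonormal_basis n a u"
proof -
  have n: "n \<ge> 1"
    using unit by (cases n) auto
  define s :: real where "s = (if a n \<ge> 0 then 1 else -1)"
  have s2: "s * s = 1" and sa: "s * a n = \<bar>a n\<bar>"
    by (auto simp: s_def)
  define d where "d = 1 + \<bar>a n\<bar>"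
  have d: "d > 0" by (simp add: d_def)
  define e :: "nat \<Rightarrow> nat \<Rightarrow> real" where "e j i = (if i = j then 1 else 0)" for j i
  define v where "v i = a i + s * e n i" for i
  define u where "u j = (\<lambda>i\<in>{1..n}. e j i - a j / d * v i)" for j
  have dotp_e: "dotp n x (e j) = x j" if "j \<in> {1..n}" for x j
    using that by (simp add: dotp_def e_def if_distrib sum.delta cong: if_cong)
  have comm: "dotp n x y = dotp n y x" for x y
    by (simp add: dotp_def mult.commute)
  have lin: "dotp n x (\<lambda>i. c * y i + c' * z i) = c * dotp n x y + c' * dotp n x z" for x y z c c'
    by (simp add: dotp_def algebra_simps sum.distrib sum_distrib_left)
  have aa: "dotp n a a = 1"
    using unit by (simp add: dotp_def power2_eq_square)
  have v_lin: "v = (\<lambda>i. 1 * a i + s * e n i)"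
    by (simp add: v_def fun_eq_iff)
  have av: "dotp n x v = dotp n x a + s * dotp n x (e n)" for x
    unfolding v_lin by (subst lin) simp
  have u_dot: "dotp n x (u j) = dotp n x (e j) - a j / d * dotp n x v" for x j
  proof -
    have "dotp n x (u j) = dotp n x (\<lambda>i. 1 * e j i + (- (a j / d)) * v i)"
      unfolding dotp_def by (intro sum.cong) (auto simp: u_def)
    then show ?thesis by (subst (asm) lin) simp
  qed
  have A: "dotp n a (u j) = 0" if "j \<in> {1..n-1}" for j
  proof -
    have "dotp n a v = d"
      using n by (simp add: av aa dotp_e sa d_def)
    moreover have "dotp n a (e j) = a j"
      using that by (intro dotp_e) auto
    ultimately show ?thesis
      using d by (simp add: u_dot)
  qed
  have B: "dotp n (u j) (u k) = (if j = k then 1 else 0)"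
    if jk: "j \<in> {1..n-1}" "k \<in> {1..n-1}" for j k
  proof -
    have ne: "j \<noteq> n" "j \<in> {1..n}" "k \<noteq> n" "k \<in> {1..n}" "n \<in> {1..n}" using jk n by auto
    have "dotp n (u j) (e k) = (if j = k then 1 else 0) - a j / d * a k"
      using ne by (simp add: dotp_e u_def e_def v_def)
    moreover have "dotp n (u j) v = - a j"
    proof -
      have "dotp n (u j) a = 0"
        using A[OF jk(1)] by (simp add: comm)
      moreover have "dotp n (u j) (e n) = - (a j / d * (a n + s))"
        using ne by (simp add: dotp_e u_def e_def v_def)
      ultimately have "dotp n (u j) v = - (a j / d * (s * (a n + s)))"
        by (simp add: av)
      also have "s * (a n + s) = d"
        using sa s2 by (simp add: d_def algebra_simps)
      finally show ?thesis using d by simp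
    qed
    ultimately show ?thesis
      using d by (simp add: u_dot[of "u j" k])
  qed
  have "orthonormal_basis n a u"
    using A B by (auto simp: orthonormal_basis_def hyperplane_def euclid_def u_def)
  then show ?thesis by blast
qed

text \<open>
  The mean on the canonical sign space agrees with the one for any mutually independent
  fair signs on any probability space.
\<close>

lemma sign_law:
  fixes X :: "'w \<Rightarrow> real"
  assumes "prob_space M" and X: "X \<in> borel_measurable M"
    and p: "measure M {w \<in> space M. X w = 1} = 1/2"
    and m: "measure M {w \<in> space M. X w = -1} = 1/2"
    and B: "B \<in> sets borel"
  shows "measure (distr M borel X) B = (if 1 \<in> B then 1/2 else 0) + (if -1 \<in> B then 1/2 else 0)"
proof -
  interpret prob_space M by fact
  note [measurable] = X B
  let ?P = "{w \<in> space M. X w = 1}" and ?M = "{w \<in> space M. X w = -1}"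
  have disj: "?P \<inter> ?M = {}" by auto
  have "prob (?P \<union> ?M) = 1"
    using finite_measure_Union[of ?P ?M] disj p m by simp
  then have ae: "AE w in M. w \<in> ?P \<union> ?M"
    by (subst (asm) prob_eq_1) simp_all
  have "prob {w \<in> space M. X w \<in> B}
      = prob ((if 1 \<in> B then ?P else {}) \<union> (if -1 \<in> B then ?M else {}))"
    by (rule finite_measure_eq_AE) (use ae in \<open>auto split: if_splits\<close>)
  also have "\<dots> = prob (if 1 \<in> B then ?P else {}) + prob (if -1 \<in> B then ?M else {})"
    by (rule finite_measure_Union) (auto split: if_splits)
  finally show ?thesis
    using p m by (auto simp: measure_distr vimage_def Int_def conj_commute)
qed

lemma sign_sum_mean_eq:
  fixes M :: "'w measure" and X :: "nat \<Rightarrow> 'w \<Rightarrow> real"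
  assumes "prob_space M"
    and ind: "prob_space.indep_vars M (\<lambda>_. borel) X {1..n}"
    and p: "\<And>k. k \<in> {1..n} \<Longrightarrow> measure M {w \<in> space M. X k w = 1} = 1/2"
    and m: "\<And>k. k \<in> {1..n} \<Longrightarrow> measure M {w \<in> space M. X k w = -1} = 1/2"
  shows "(LINT w|M. \<bar>\<Sum>k=1..n. a k * X k w\<bar>) = sign_sum_mean n a"
proof (cases "n = 0")
  case True
  then show ?thesis by (simp add: sign_sum_mean_def)
next
  case False
  then have ne: "{1..n} \<noteq> {}" by simp
  interpret prob_space M by fact
  let ?N = "measure_pmf (signs_pmf n)"
  let ?f = "\<lambda>e. \<bar>\<Sum>k=1..n. a k * e k\<bar> :: real"
  have X: "X k \<in> borel_measurable M" if "k \<in> {1..n}" for k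
    using ind that unfolding indep_vars_def by auto
  have indN: "prob_space.indep_vars ?N (\<lambda>_. borel) (\<lambda>k e. e k) {1..n}"
    unfolding signs_pmf_def
    by (rule prob_space.indep_vars_compose2[OF measure_pmf.prob_space_axioms
          indep_vars_Pi_pmf, where Y = "\<lambda>_ x. x", simplified]) auto
  have pN: "measure ?N {e \<in> space ?N. e k = y} = 1/2" if "k \<in> {1..n}" "y = 1 \<or> y = -1" for k and y :: real
  proof -
    have "measure ?N {e \<in> space ?N. e k = y} = measure (map_pmf (\<lambda>e. e k) (signs_pmf n)) {y}"
      by (simp add: vimage_def)
    also have "map_pmf (\<lambda>e. e k) (signs_pmf n) = pmf_of_set {-1, 1}"
      unfolding signs_pmf_def using that by (subst Pi_pmf_component) auto
    also have "measure (pmf_of_set {-1, 1}) {y} = 1/2"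
      using that by (auto simp: measure_pmf_of_set)
    finally show ?thesis .
  qed
  have law: "distr M borel (X k) = distr ?N borel (\<lambda>e. e k)" if k: "k \<in> {1..n}" for k
  proof (rule measure_eqI)
    fix B assume "B \<in> sets (distr M borel (X k))"
    then have B: "B \<in> sets borel" by simp
    interpret D: prob_space "distr M borel (X k)"
      by (rule prob_space_distr) (rule X[OF k])
    interpret E: prob_space "distr ?N borel (\<lambda>e. e k)"
      by (rule measure_pmf.prob_space_distr) simp
    have "measure (distr M borel (X k)) B = measure (distr ?N borel (\<lambda>e. e k)) B"
      using sign_law[OF prob_space_axioms X[OF k] p[OF k] m[OF k] B]
        sign_law[OF measure_pmf.prob_space_axioms _ pN[OF k] pN[OF k] B] by simp
    then show "emeasure (distr M borel (X k)) B = emeasure (distr ?N borel (\<lambda>e. e k)) B"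
      by (simp add: D.emeasure_eq_measure E.emeasure_eq_measure)
  qed simp
  have f: "?f \<in> borel_measurable (PiM {1..n} (\<lambda>_. borel))"
    by measurable
  have res: "?f (\<lambda>i\<in>{1..n}. g i) = ?f g" for g
    by (intro arg_cong[where f = abs] sum.cong) auto
  have "(LINT w|M. ?f (\<lambda>k. X k w))
      = (LINT w|M. ?f (\<lambda>k\<in>{1..n}. X k w))"
    by (simp only: res)
  also have "\<dots> = (LINT e|distr M (PiM {1..n} (\<lambda>_. borel)) (\<lambda>w. \<lambda>k\<in>{1..n}. X k w). ?f e)"
    by (rule integral_distr[symmetric, OF _ f]) (intro measurable_restrict X)
  also have "distr M (PiM {1..n} (\<lambda>_. borel)) (\<lambda>w. \<lambda>k\<in>{1..n}. X k w)
      = PiM {1..n} (\<lambda>k. distr M borel (X k))"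
    using indep_vars_iff_distr_eq_PiM'[of "{1..n}" X "\<lambda>_. borel", OF ne X] ind by blast
  also have "\<dots> = PiM {1..n} (\<lambda>k. distr ?N borel (\<lambda>e. e k))"
    by (rule PiM_cong) (auto simp: law)
  also have "\<dots> = distr ?N (PiM {1..n} (\<lambda>_. borel)) (\<lambda>e. \<lambda>k\<in>{1..n}. e k)"
    using prob_space.indep_vars_iff_distr_eq_PiM'[OF measure_pmf.prob_space_axioms ne,
        of "\<lambda>k e. e k" "signs_pmf n" "\<lambda>_. borel"] indN by simp
  also have "(LINT e|\<dots>. ?f e) = (LINT e|?N. ?f (\<lambda>k\<in>{1..n}. e k))"
    by (rule integral_distr[OF _ f]) (intro measurable_restrict; simp)
  also have "\<dots> = sign_sum_mean n a"
    by (simp only: res sign_sum_mean_def)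
  finally show ?thesis .
qed

end

theory Submission
  imports Defs
begin

text \<open>
  Both factors are bounded below through characteristic functions, with errors controlled by
  \<open>\<Sum>j. (a j) ^ 4 \<le> c0\<^sup>2 / n\<close>.

  For the signs, \<open>\<bar>x\<bar> \<ge> 2/\<pi> \<integral>\<^bsub>\<epsilon>\<^esub>\<^bsup>T\<^esup> (1 - cos (t x)) / t\<^sup>2 dt\<close>, and the mean of
  \<open>cos (t \<Sum>k. a k \<epsilon> k)\<close> is \<open>\<Prod>k. cos (t a k) \<approx> exp (- t\<^sup>2/2)\<close>; letting \<open>T\<close> grow gives a bound
  tending to \<open>sqrt (2/\<pi>)\<close>.

  For the section, let \<open>Y = \<Sum>k. a k y k\<close> with \<open>y\<close> uniform in the cube. The law of \<open>Y\<close> is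
  symmetric and unimodal, so the windows \<open>\<bar>x + Y\<bar> \<le> c\<close> are most likely for \<open>x = 0\<close>. Averaging
  over a Gaussian \<open>x\<close> of variance \<open>1/s\<close> and letting \<open>c \<rightarrow> 0\<close> bounds the central section below by
  \<open>sqrt (s/(2\<pi>))\<close> times the mean of \<open>exp (- s Y\<^sup>2/2)\<close>. That mean is a Gaussian average of
  \<open>\<Prod>k. sinc (t a k / 2)\<close>, close to \<open>1 / sqrt (1 + s/12)\<close>. With \<open>s = 60\<close> the bound tends to
  \<open>sqrt (5/\<pi>)\<close>, and \<open>sqrt (2/\<pi>) sqrt (5/\<pi>) = sqrt 10 / \<pi> > 1\<close> leaves room for the errors.
\<close>

section \<open>Gaussian approximation of products\<close>

lemma exp_neg_taylor2:
  fixes w :: real assumes "0 \<le> w"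
  shows "1 - w \<le> exp (- w)" "exp (- w) \<le> 1 - w + w\<^sup>2 / 2"
proof -
  show "1 - w \<le> exp (- w)"
    using exp_ge_add_one_self[of "-w"] by simp
  define h where "h x = 1 - x + x\<^sup>2 / 2 - exp (- x)" for x :: real
  have "h 0 \<le> h w"
  proof (rule DERIV_nonneg_imp_nondecreasing[OF assms])
    fix x :: real assume "0 \<le> x"
    have "(h has_real_derivative (- 1 + x + exp (- x))) (at x)"
      unfolding h_def by (auto intro!: derivative_eq_intros)
    moreover have "- 1 + x + exp (- x) \<ge> 0"
      using exp_ge_add_one_self[of "-x"] by simp
    ultimately show "\<exists>y. (h has_real_derivative y) (at x) \<and> 0 \<le> y" by blast
  qed
  then show "exp (- w) \<le> 1 - w + w\<^sup>2 / 2"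
    by (simp add: h_def)
qed

text \<open>Both functions agree with 1 - x^2/2 up to fourth order: the Lagrange remainder of the
  cosine is at most x^4/24 and that of the exponential at most x^4/8. The constant 1 in front of x^4
  is generous.\<close>

lemma abs_cos_minus_exp_le:
  fixes x :: real
  shows "\<bar>cos x - exp (- (x\<^sup>2 / 2))\<bar> \<le> x ^ 4"
proof -
  obtain t where "cos x = (\<Sum>m<4. cos_coeff m * x ^ m) + (cos (t + 1/2 * real 4 * pi) / fact 4) * x ^ 4"
    using Maclaurin_cos_expansion[of x 4] by blast
  moreover have "(\<Sum>m<4. cos_coeff m * x ^ m) = 1 - x\<^sup>2 / 2"
    by (simp add: lessThan_nat_numeral lessThan_Suc cos_coeff_def fact_numeral)
  ultimately have "\<bar>cos x - (1 - x\<^sup>2 / 2)\<bar> = \<bar>cos (t + 1/2 * real 4 * pi)\<bar> * (x ^ 4 / 24)"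
    by (simp add: abs_mult fact_numeral power_even_abs)
  also have "\<dots> \<le> 1 * (x ^ 4 / 24)"
    by (intro mult_right_mono abs_cos_le_one) simp
  finally have "\<bar>cos x - (1 - x\<^sup>2 / 2)\<bar> \<le> x ^ 4 / 24"
    by simp
  moreover have "exp (- (x\<^sup>2 / 2)) \<le> 1 - x\<^sup>2 / 2 + x ^ 4 / 8" "1 - x\<^sup>2 / 2 \<le> exp (- (x\<^sup>2 / 2))"
    using exp_neg_taylor2[of "x\<^sup>2 / 2"] by (simp_all add: power_divide)
  moreover have "0 \<le> x ^ 4" by simp
  ultimately show ?thesis by linarith
qed

text \<open>The common Taylor polynomial is now 1 - x^2/6, with remainders x^4/120 for
  \<open>sinc\<close> and x^4/72 for the exponential.\<close>

lemma abs_sinc_minus_exp_le: "\<bar>sinc x - exp (- (x\<^sup>2 / 6))\<bar> \<le> x ^ 4"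
proof -
  have "\<bar>sinc x - (1 - x\<^sup>2 / 6)\<bar> \<le> x ^ 4 / 120"
  proof (cases "x = 0")
    case False
    have "(\<Sum>m<5. sin_coeff m * x ^ m) = x - x ^ 3 / 6"
      by (simp add: lessThan_nat_numeral lessThan_Suc sin_coeff_def fact_numeral)
    then have "\<bar>sin x - (x - x ^ 3 / 6)\<bar> \<le> \<bar>x\<bar> ^ 5 / 120"
      using Maclaurin_sin_bound[of x 5] by (simp add: fact_numeral)
    moreover have "sinc x - (1 - x\<^sup>2 / 6) = (sin x - (x - x ^ 3 / 6)) / x"
      using False by (simp add: field_simps power2_eq_square power3_eq_cube)
    moreover have "\<bar>x\<bar> ^ 5 / 120 / \<bar>x\<bar> = x ^ 4 / 120"
      using False by (simp add: field_simps eval_nat_numeral)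
    ultimately show ?thesis
      using divide_right_mono[of _ _ "\<bar>x\<bar>"] by (metis abs_divide abs_ge_zero)
  qed simp
  moreover have "exp (- (x\<^sup>2 / 6)) \<le> 1 - x\<^sup>2 / 6 + x ^ 4 / 72" "1 - x\<^sup>2 / 6 \<le> exp (- (x\<^sup>2 / 6))"
    using exp_neg_taylor2[of "x\<^sup>2 / 6"] by (simp_all add: power_divide)
  moreover have "0 \<le> x ^ 4" by simp
  ultimately show ?thesis by linarith
qed

lemma abs_sinc_le_1: "\<bar>sinc x\<bar> \<le> 1"
  using abs_sin_le_one[of x] abs_sin_x_le_abs_x[of x] by (auto simp: divide_simps)

text \<open>A product of factors bounded by 1 changes by at most the sum of the changes of its
  factors, and the Gaussian factors multiply to a single Gaussian because the squares of
  \<open>a\<close> sum to 1. It serves the cosine with \<kappa> = 1/2 and \<open>sinc\<close> with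
  \<kappa> = 1/6.\<close>

lemma prod_minus_gauss_le:
  fixes f :: "real \<Rightarrow> real"
  assumes le1: "\<And>x. \<bar>f x\<bar> \<le> 1" and \<kappa>: "0 \<le> \<kappa>"
    and approx: "\<And>x. \<bar>f x - exp (- (\<kappa> * x\<^sup>2))\<bar> \<le> x ^ 4"
    and I: "(\<Sum>i\<in>I. (a i)\<^sup>2) = 1"
  shows "\<bar>(\<Prod>i\<in>I. f (t * a i)) - exp (- (\<kappa> * t\<^sup>2))\<bar> \<le> t ^ 4 * (\<Sum>i\<in>I. (a i) ^ 4)"
proof -
  \<comment> \<open>A sum over an infinite set is 0 by convention, so the normalisation forces
    finiteness.\<close>
  have fin: "finite I"
    using I by (metis sum.infinite zero_neq_one)
  have "(\<Prod>i\<in>I. exp (- (\<kappa> * (t * a i)\<^sup>2))) = exp (\<Sum>i\<in>I. - (\<kappa> * (t * a i)\<^sup>2))"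
    using fin by (simp add: exp_sum)
  also have "(\<Sum>i\<in>I. - (\<kappa> * (t * a i)\<^sup>2)) = - (\<kappa> * t\<^sup>2 * (\<Sum>i\<in>I. (a i)\<^sup>2))"
    by (simp add: sum_negf sum_distrib_left power_mult_distrib mult_ac)
  finally have "\<bar>(\<Prod>i\<in>I. f (t * a i)) - exp (- (\<kappa> * t\<^sup>2))\<bar>
      = norm ((\<Prod>i\<in>I. f (t * a i)) - (\<Prod>i\<in>I. exp (- (\<kappa> * (t * a i)\<^sup>2))))"
    using I by simp
  also have "\<dots> \<le> (\<Sum>i\<in>I. norm (f (t * a i) - exp (- (\<kappa> * (t * a i)\<^sup>2))))"
    by (rule norm_prod_diff) (use le1 \<kappa> in auto)
  also have "\<dots> \<le> (\<Sum>i\<in>I. (t * a i) ^ 4)"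
    using approx by (intro sum_mono) simp
  finally show ?thesis
    by (simp add: power_mult_distrib sum_distrib_left)
qed

section \<open>The mean of the sign sum\<close>

text \<open>Integration by parts of (1 - cos u)/u^2 leads to this antiderivative on the positive
  half-line.\<close>

definition Si_defect :: "real \<Rightarrow> real" where
  "Si_defect u = Si u - (1 - cos u) / u"

lemma DERIV_Si_defect:
  assumes "u > 0"
  shows "(Si_defect has_real_derivative (1 - cos u) / u\<^sup>2) (at u)"
proof -
  have "((\<lambda>u. 1 - cos u) has_real_derivative sin u) (at u)"
    by (auto intro!: derivative_eq_intros)
  from DERIV_diff[OF DERIV_Si DERIV_divide[OF this DERIV_ident]] assms
  have "(Si_defect has_real_derivative sinc u - (sin u * u - (1 - cos u) * 1) / (u * u)) (at u)"
    unfolding Si_defect_def by simp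
  moreover have "sinc u - (sin u * u - (1 - cos u) * 1) / (u * u) = (1 - cos u) / u\<^sup>2"
    using assms by (simp add: field_simps power2_eq_square)
  ultimately show ?thesis by simp
qed

lemma Si_defect_mono:
  assumes "0 < u" "u \<le> v"
  shows "Si_defect u \<le> Si_defect v"
proof (rule DERIV_nonneg_imp_nondecreasing[OF assms(2)])
  fix x assume "u \<le> x"
  then have "0 < x" using assms by simp
  then show "\<exists>y. (Si_defect has_real_derivative y) (at x) \<and> 0 \<le> y"
    by (intro exI[of _ "(1 - cos x) / x\<^sup>2"] conjI DERIV_Si_defect) simp_all
qed

text \<open>The function is monotone, so its values lie between its limits: (1 - cos u)/u vanishes
  at 0 and at infinity, while \<open>Si\<close> tends to 0 and to pi/2.\<close>

lemma Si_defect_bounds: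
  assumes u: "0 < u"
  shows "0 \<le> Si_defect u" "Si_defect u \<le> pi / 2"
proof -
  have "(Si \<longlongrightarrow> Si 0) (at_right 0)"
    using isCont_Si[of 0] by (simp add: isCont_def filterlim_at_split)
  moreover have "((\<lambda>x. 1 - cos x) has_real_derivative 0) (at 0)"
    by (auto intro!: derivative_eq_intros)
  then have "((\<lambda>x. (1 - cos x) / x) \<longlongrightarrow> 0) (at_right (0::real))"
    by (simp add: DERIV_def filterlim_at_split)
  ultimately have "(Si_defect \<longlongrightarrow> Si 0 - 0) (at_right 0)"
    unfolding Si_defect_def by (rule tendsto_diff)
  moreover have "Si 0 = 0" using Si_neg[of 0, unfolded minus_zero, OF order_refl] by linarith
  ultimately have "(Si_defect \<longlongrightarrow> 0) (at_right 0)" by simp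
  moreover have "\<forall>\<^sub>F v in at_right 0. Si_defect v \<le> Si_defect u"
    using eventually_at_right_less[of 0] eventually_at_right_real[OF u]
    by eventually_elim (auto intro: Si_defect_mono)
  ultimately show "0 \<le> Si_defect u"
    by (intro tendsto_upperbound) auto
  have "((\<lambda>x::real. (1 - cos x) / x) \<longlongrightarrow> 0) at_top"
  proof (rule tendsto_sandwich)
    show "\<forall>\<^sub>F x::real in at_top. 0 \<le> (1 - cos x) / x"
      using eventually_gt_at_top[of 0] by eventually_elim simp
    show "\<forall>\<^sub>F x::real in at_top. (1 - cos x) / x \<le> 2 / x"
      using eventually_gt_at_top[of 0]
    proof eventually_elim
      case (elim x)
      then show ?case using cos_ge_minus_one[of x] by (intro divide_right_mono) linarith+
    qed
    show "((\<lambda>x. 2 / x) \<longlongrightarrow> 0) (at_top :: real filter)"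
      by (rule real_tendsto_divide_at_top[OF tendsto_const filterlim_ident])
  qed simp
  then have "(Si_defect \<longlongrightarrow> pi / 2 - 0) at_top"
    unfolding Si_defect_def by (intro tendsto_diff Si_at_top)
  moreover have "\<forall>\<^sub>F v in at_top. Si_defect u \<le> Si_defect v"
    using eventually_ge_at_top[of u] by eventually_elim (auto intro: Si_defect_mono u)
  ultimately show "Si_defect u \<le> pi / 2"
    by (intro tendsto_lowerbound[of Si_defect _ at_top]) auto
qed

text \<open>Over the whole half-line the integral would be exactly (pi/2) |x|. The substitution u =
  t |x| reduces the truncated one to an increment of \<open>Si_defect\<close>, which is at most
  pi/2; staying above \<epsilon> avoids the singular point 0.\<close>

lemma integral_one_minus_cos_le:
  fixes \<epsilon> T x :: real
  assumes \<epsilon>: "0 < \<epsilon>" "\<epsilon> \<le> T"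
  shows "integral {\<epsilon>..T} (\<lambda>t. (1 - cos (t * x)) / t\<^sup>2) \<le> pi / 2 * \<bar>x\<bar>"
proof (cases "x = 0")
  case False
  define y where "y = \<bar>x\<bar>"
  have y: "y > 0" using False by (simp add: y_def)
  have cos_y: "cos (t * x) = cos (t * y)" for t
    using cos_minus[of "t * x"] by (auto simp: y_def abs_if)
  have "((\<lambda>t. (1 - cos (t * x)) / t\<^sup>2) has_integral
      y * Si_defect (T * y) - y * Si_defect (\<epsilon> * y)) {\<epsilon>..T}"
  proof (rule fundamental_theorem_of_calculus[OF \<epsilon>(2)])
    fix t assume "t \<in> {\<epsilon>..T}"
    then have t: "t > 0" using \<epsilon> by simp
    have "((\<lambda>t. Si_defect (t * y)) has_real_derivative ((1 - cos (t * y)) / (t * y)\<^sup>2 * y)) (at t)"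
      by (rule DERIV_chain2[OF DERIV_Si_defect]) (use t y in \<open>auto intro!: derivative_eq_intros\<close>)
    then have "((\<lambda>t. y * Si_defect (t * y)) has_real_derivative (y * ((1 - cos (t * y)) / (t * y)\<^sup>2 * y))) (at t)"
      by (rule DERIV_cmult)
    moreover have "y * ((1 - cos (t * y)) / (t * y)\<^sup>2 * y) = (1 - cos (t * x)) / t\<^sup>2"
      using t y by (simp add: cos_y power2_eq_square)
    ultimately show "((\<lambda>t. y * Si_defect (t * y)) has_vector_derivative (1 - cos (t * x)) / t\<^sup>2) (at t within {\<epsilon>..T})"
      by (simp add: has_real_derivative_iff_has_vector_derivative has_vector_derivative_at_within)
  qed
  then have "integral {\<epsilon>..T} (\<lambda>t. (1 - cos (t * x)) / t\<^sup>2) = y * (Si_defect (T * y) - Si_defect (\<epsilon> * y))"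
    by (simp add: integral_unique right_diff_distrib)
  also have "\<dots> \<le> y * (pi / 2)"
    using Si_defect_bounds[of "T * y"] Si_defect_bounds[of "\<epsilon> * y"] y \<epsilon>
    by (intro mult_left_mono) auto
  finally show ?thesis by (simp add: y_def mult.commute)
next
  case True
  then have "(\<lambda>t. (1 - cos (t * x)) / t\<^sup>2) = (\<lambda>_. 0)"
    by (simp add: fun_eq_iff)
  then show ?thesis
    by (simp only: Henstock_Kurzweil_Integration.integral_0) simp
qed

text \<open>The inductions over the coordinates, for the signs and for the cube alike, bring in the
  new coordinate by a function update.\<close>

lemma sum_insert_update:
  fixes b y :: "'i \<Rightarrow> real"
  assumes "finite I" "i \<notin> I"
  shows "(\<Sum>k\<in>insert i I. b k * (if k = i then s else y k)) = b i * s + (\<Sum>k\<in>I. b k * y k)"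
proof -
  have "(\<Sum>k\<in>I. b k * (if k = i then s else y k)) = (\<Sum>k\<in>I. b k * y k)"
    using assms by (intro sum.cong) auto
  then show ?thesis using assms by simp
qed

text \<open>The free phase \<open>x\<close> lets the induction absorb the new term. Averaging over
  its sign gives (cos (x - b) + cos (x + b))/2 = cos x cos b.\<close>

lemma expectation_cos_signs:
  assumes "finite I"
  shows "measure_pmf.expectation (Pi_pmf I 0 (\<lambda>_. pmf_of_set {-1, 1 :: real}))
      (\<lambda>e. cos (x + (\<Sum>k\<in>I. b k * e k))) = cos x * (\<Prod>k\<in>I. cos (b k))"
  using assms
proof (induction I arbitrary: x rule: finite_induct)
  case (insert i I)
  let ?P = "Pi_pmf I 0 (\<lambda>_. pmf_of_set {-1, 1 :: real})"
  note upd = sum_insert_update[OF insert.hyps]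
  have fin: "finite (set_pmf ?P)"
    using insert.hyps by (auto simp: set_Pi_pmf intro!: finite_PiE_dflt)
  have "measure_pmf.expectation (Pi_pmf (insert i I) 0 (\<lambda>_. pmf_of_set {-1, 1 :: real}))
      (\<lambda>e. cos (x + (\<Sum>k\<in>insert i I. b k * e k)))
    = (\<Sum>y\<in>{-1,1}. measure_pmf.expectation ?P (\<lambda>f. cos ((x + b i * y) + (\<Sum>k\<in>I. b k * f k))) / 2)"
    using insert.hyps fin
    by (subst Pi_pmf_insert') (simp_all add: pmf_expectation_bind_pmf_of_set upd map_pmf_def[symmetric] add.assoc del: sum.insert)
  also have "\<dots> = (cos (x - b i) + cos (x + b i)) / 2 * (\<Prod>k\<in>I. cos (b k))"
    by (simp add: insert.IH[of "x - b i"] insert.IH[of "x + b i"] add_divide_distrib distrib_right)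
  also have "(cos (x - b i) + cos (x + b i)) / 2 = cos x * cos (b i)"
    by (simp add: cos_add cos_diff)
  finally show ?case using insert.hyps by simp
qed simp

text \<open>Averaging \<open>integral_one_minus_cos_le\<close> over the signs leaves the integrand
  (1 - prod cos (t a_k))/t^2. Three losses occur: \<epsilon> from the cut near 0, 1/T from a
  boundary term, and the Gaussian approximation, whose error is at most T^2 times the fourth power
  sum on an interval of length at most T.\<close>

lemma sign_sum_mean_ge:
  assumes unit: "(\<Sum>j=1..n. (a j)\<^sup>2) = 1" and \<epsilon>: "0 < \<epsilon>" "\<epsilon> \<le> T"
  shows "sign_sum_mean n a \<ge>
    2 / pi * (integral {0..T} (\<lambda>t. exp (- (t\<^sup>2 / 2))) - \<epsilon> - 1 / T - T ^ 3 * (\<Sum>j=1..n. (a j) ^ 4))"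
proof -
  define S where "S = (\<Sum>j=1..n. (a j) ^ 4)"
  have S: "S \<ge> 0" by (simp add: S_def sum_nonneg)
  let ?P = "signs_pmf n"
  define X where "X e = (\<Sum>k=1..n. a k * e k)" for e :: "nat \<Rightarrow> real"
  define A where "A = set_pmf ?P"
  have fin: "finite A"
    unfolding A_def signs_pmf_def
    by (auto simp: set_Pi_pmf intro!: finite_PiE_dflt)
  \<comment> \<open>The sign space has finite support, so exchanging mean and integral is mere
    linearity.\<close>
  have E: "measure_pmf.expectation ?P f = (\<Sum>e\<in>A. f e * pmf ?P e)" for f :: "(nat \<Rightarrow> real) \<Rightarrow> real"
    by (rule integral_measure_pmf_real) (use fin in \<open>auto simp: A_def\<close>)
  let ?c = "\<lambda>x t :: real. (1 - cos (t * x)) / t\<^sup>2"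
  let ?g = "\<lambda>t :: real. exp (- (t\<^sup>2 / 2))"
  have pos: "t \<noteq> 0" if "t \<in> {\<epsilon>..T}" for t using that \<epsilon> by auto
  have int_c: "?c x integrable_on {\<epsilon>..T}" for x
    by (intro integrable_continuous_interval continuous_intros) (use pos in auto)
  have int_g: "?g integrable_on {u..v}" for u v
    by (intro integrable_continuous_interval continuous_intros) auto
  have mean: "(\<Sum>e\<in>A. ?c (X e) t * pmf ?P e) = (1 - (\<Prod>k=1..n. cos (t * a k))) / t\<^sup>2" for t
  proof -
    have "(\<Sum>e\<in>A. cos (t * X e) * pmf ?P e) = (\<Prod>k=1..n. cos (t * a k))"
      using expectation_cos_signs[of "{1..n}" 0 "\<lambda>k. t * a k", folded signs_pmf_def, unfolded E]
      by (simp add: X_def sum_distrib_left mult.assoc)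
    moreover have "(\<Sum>e\<in>A. pmf ?P e) = 1"
      using E[of "\<lambda>_. 1"] by simp
    moreover have "(\<Sum>e\<in>A. ?c (X e) t * pmf ?P e)
       = ((\<Sum>e\<in>A. pmf ?P e) - (\<Sum>e\<in>A. cos (t * X e) * pmf ?P e)) / t\<^sup>2"
      by (simp add: sum_divide_distrib sum_subtractf[symmetric] left_diff_distrib diff_divide_distrib)
    ultimately show ?thesis by simp
  qed
  \<comment> \<open>Integration by parts: (1 - g)/t^2 and g differ by the derivative of -(1 - g)/t,
    so the Gaussian version of the integrand can be traded for g at the price of boundary
    terms.\<close>
  have defect: "((\<lambda>t. (1 - ?g t) / t\<^sup>2 - ?g t) has_integral (- ((1 - ?g T) / T) - - ((1 - ?g \<epsilon>) / \<epsilon>))) {\<epsilon>..T}"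
  proof (rule fundamental_theorem_of_calculus[OF \<epsilon>(2)])
    fix t assume "t \<in> {\<epsilon>..T}"
    then have t: "t > 0" using \<epsilon> by simp
    have "((\<lambda>t. - ((1 - ?g t) / t)) has_real_derivative (1 - ?g t) / t\<^sup>2 - ?g t) (at t)"
    proof -
      have "(?g has_real_derivative - (t * ?g t)) (at t)"
        by (auto intro!: derivative_eq_intros)
      from DERIV_minus[OF DERIV_divide[OF DERIV_diff[OF DERIV_const[of 1] this] DERIV_ident]] t
      have "((\<lambda>t. - ((1 - ?g t) / t)) has_real_derivative - (((0 - - (t * ?g t)) * t - (1 - ?g t) * 1) / (t * t))) (at t)"
        by simp
      moreover have "- (((0 - - (t * ?g t)) * t - (1 - ?g t) * 1) / (t * t)) = (1 - ?g t) / t\<^sup>2 - ?g t"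
        using t by (simp add: divide_simps power2_eq_square)
      ultimately show ?thesis by simp
    qed
    then show "((\<lambda>t. - ((1 - ?g t) / t)) has_vector_derivative (1 - ?g t) / t\<^sup>2 - ?g t) (at t within {\<epsilon>..T})"
      by (simp add: has_real_derivative_iff_has_vector_derivative has_vector_derivative_at_within)
  qed
  have "integral {0..\<epsilon>} ?g \<le> integral {0..\<epsilon>} (\<lambda>_. 1)"
    by (intro integral_le int_g) auto
  then have "integral {0..\<epsilon>} ?g \<le> \<epsilon>" using \<epsilon> by simp
  moreover have "integral {0..\<epsilon>} ?g + integral {\<epsilon>..T} ?g = integral {0..T} ?g"
    by (rule Henstock_Kurzweil_Integration.integral_combine) (use \<epsilon> int_g in auto)
  ultimately have g_ge: "integral {\<epsilon>..T} ?g \<ge> integral {0..T} ?g - \<epsilon>" by linarith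
  have "integral {0..T} ?g - \<epsilon> - 1 / T - T ^ 3 * S
      \<le> integral {\<epsilon>..T} ?g + (- ((1 - ?g T) / T) - - ((1 - ?g \<epsilon>) / \<epsilon>)) - T\<^sup>2 * S * (T - \<epsilon>)"
  proof -
    have "(1 - ?g T) / T \<le> 1 / T" using \<epsilon> by (intro divide_right_mono) auto
    moreover have "0 \<le> (1 - ?g \<epsilon>) / \<epsilon>" using \<epsilon> by (intro divide_nonneg_pos) auto
    moreover have "T\<^sup>2 * S * (T - \<epsilon>) \<le> T\<^sup>2 * S * T" using S \<epsilon> by (intro mult_left_mono) auto
    then have "T\<^sup>2 * S * (T - \<epsilon>) \<le> T ^ 3 * S" by (simp add: power2_eq_square power3_eq_cube mult_ac)
    ultimately show ?thesis using g_ge by linarith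
  qed
  also have "\<dots> = integral {\<epsilon>..T} (\<lambda>t. ?g t + ((1 - ?g t) / t\<^sup>2 - ?g t) - T\<^sup>2 * S)"
  proof -
    have "((\<lambda>_. T\<^sup>2 * S) has_integral (T - \<epsilon>) * (T\<^sup>2 * S)) {\<epsilon>..T}"
      using has_integral_const_real[of "T\<^sup>2 * S" \<epsilon> T] \<epsilon> by simp
    from has_integral_diff[OF has_integral_add[OF integrable_integral[OF int_g] defect] this]
    show ?thesis by (simp add: integral_unique mult.commute)
  qed
  also have "\<dots> \<le> integral {\<epsilon>..T} (\<lambda>t. (1 - (\<Prod>k=1..n. cos (t * a k))) / t\<^sup>2)"
  proof (rule integral_le)
    show "(\<lambda>t. ?g t + ((1 - ?g t) / t\<^sup>2 - ?g t) - T\<^sup>2 * S) integrable_on {\<epsilon>..T}"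
      "(\<lambda>t. (1 - (\<Prod>k=1..n. cos (t * a k))) / t\<^sup>2) integrable_on {\<epsilon>..T}"
      by (intro integrable_continuous_interval continuous_intros; use pos in auto)+
    fix t assume t: "t \<in> {\<epsilon>..T}"
    have "\<bar>(\<Prod>k=1..n. cos (t * a k)) - exp (- (1/2 * t\<^sup>2))\<bar> \<le> t ^ 4 * (\<Sum>i=1..n. (a i) ^ 4)"
      by (rule prod_minus_gauss_le) (use unit abs_cos_minus_exp_le in auto)
    then have "1 - ?g t - t ^ 4 * S \<le> 1 - (\<Prod>k=1..n. cos (t * a k))"
      by (simp add: S_def)
    then have "(1 - ?g t - t ^ 4 * S) / t\<^sup>2 \<le> (1 - (\<Prod>k=1..n. cos (t * a k))) / t\<^sup>2"
      by (rule divide_right_mono) simp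
    moreover have "(1 - ?g t - t ^ 4 * S) / t\<^sup>2 = (1 - ?g t) / t\<^sup>2 - t\<^sup>2 * S"
      using pos[OF t] by (simp add: diff_divide_distrib power2_eq_square power4_eq_xxxx)
    moreover have "t\<^sup>2 * S \<le> T\<^sup>2 * S"
      using t \<epsilon> S by (intro mult_right_mono power_mono) auto
    ultimately show "?g t + ((1 - ?g t) / t\<^sup>2 - ?g t) - T\<^sup>2 * S \<le> (1 - (\<Prod>k=1..n. cos (t * a k))) / t\<^sup>2"
      by linarith
  qed
  also have "\<dots> = integral {\<epsilon>..T} (\<lambda>t. \<Sum>e\<in>A. ?c (X e) t * pmf ?P e)"
    by (simp only: mean)
  also have "\<dots> = (\<Sum>e\<in>A. integral {\<epsilon>..T} (?c (X e)) * pmf ?P e)"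
    by (subst integral_sum[OF fin], rule integrable_on_mult_left[OF int_c],
      simp only: Henstock_Kurzweil_Integration.integral_mult_left)
  also have "\<dots> \<le> (\<Sum>e\<in>A. pi / 2 * \<bar>X e\<bar> * pmf ?P e)"
    by (intro sum_mono mult_right_mono integral_one_minus_cos_le \<epsilon>) simp
  also have "\<dots> = pi / 2 * sign_sum_mean n a"
    by (simp add: sign_sum_mean_def E X_def sum_distrib_left mult.assoc)
  finally show ?thesis
    by (simp add: S_def field_simps)
qed

text \<open>Rescaling by sqrt 2 reduces this to the half-line integral of exp (- x^2), which is sqrt
  pi / 2.\<close>

lemma tendsto_integral_gauss:
  "((\<lambda>T. integral {0..T} (\<lambda>t. exp (- (t\<^sup>2 / 2)))) \<longlongrightarrow> sqrt (pi / 2)) at_top"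
proof -
  let ?f = "\<lambda>x::real. indicator {0..} x *\<^sub>R exp (- (x\<^sup>2 / 2))"
  have "has_bochner_integral lborel (\<lambda>x. indicator {0..} (0 + 1 / sqrt 2 * x) *\<^sub>R exp (- (0 + 1 / sqrt 2 * x)\<^sup>2))
     ((sqrt pi / 2) /\<^sub>R \<bar>1 / sqrt 2\<bar>)"
    by (subst lborel_has_bochner_integral_real_affine_iff[symmetric]) (use gaussian_moment_0 in simp_all)
  moreover have "(\<lambda>x. indicator {0..} (0 + 1 / sqrt 2 * x) *\<^sub>R exp (- (0 + 1 / sqrt 2 * x)\<^sup>2)) = ?f"
    by (auto simp: fun_eq_iff indicator_def power_divide zero_le_divide_iff)
  moreover have "(sqrt pi / 2) /\<^sub>R \<bar>1 / sqrt 2\<bar> = sqrt (pi / 2)"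
    by (simp add: real_sqrt_divide field_simps)
  ultimately have B: "has_bochner_integral lborel ?f (sqrt (pi / 2))" by simp
  have "((\<lambda>y. \<integral>x. indicator {..y} x *\<^sub>R ?f x \<partial>lborel) \<longlongrightarrow> \<integral>x. ?f x \<partial>lborel) at_top"
    by (rule tendsto_integral_at_top) (use B in \<open>auto simp: has_bochner_integral_iff\<close>)
  moreover have "(\<integral>x. indicator {..y} x *\<^sub>R ?f x \<partial>lborel) = integral {0..y} (\<lambda>t. exp (- (t\<^sup>2 / 2)))" for y
  proof -
    have "set_integrable lborel {0..y} (\<lambda>t. exp (- (t\<^sup>2 / 2)))"
      by (rule borel_integrable_atLeastAtMost') (intro continuous_intros, auto)
    from set_borel_integral_eq_integral(2)[OF this]
    show ?thesis
      unfolding set_lebesgue_integral_def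
      by (subst Bochner_Integration.integral_cong[OF refl, of _ _ "\<lambda>x. indicator {0..y} x *\<^sub>R exp (- (x\<^sup>2 / 2))"])
        (auto simp: indicator_def)
  qed
  moreover have "(\<integral>x. ?f x \<partial>lborel) = sqrt (pi / 2)"
    using B by (simp add: has_bochner_integral_iff)
  ultimately show ?thesis by simp
qed

section \<open>Symmetric unimodality on the cube\<close>

text \<open>The inequality also forces evenness, since x and -x bound each other in absolute value.
  Values in \<open>ennreal\<close> make every integral below defined.\<close>

definition symmetric_unimodal :: "(real \<Rightarrow> ennreal) \<Rightarrow> bool" where
  "symmetric_unimodal g \<longleftrightarrow> g \<in> borel_measurable borel \<and> (\<forall>x y. \<bar>x\<bar> \<le> \<bar>y\<bar> \<longrightarrow> g y \<le> g x)"

lemma symmetric_unimodalD: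
  "symmetric_unimodal g \<Longrightarrow> \<bar>x\<bar> \<le> \<bar>y\<bar> \<Longrightarrow> g y \<le> g x"
  by (simp add: symmetric_unimodal_def)

abbreviation unit_interval :: "real measure" where
  "unit_interval \<equiv> density lborel (indicator {-1/2..1/2})"

lemma prob_space_unit_interval: "prob_space unit_interval"
  by (rule prob_spaceI) (simp add: emeasure_density)

interpretation unit_interval: prob_space unit_interval
  by (rule prob_space_unit_interval)

interpretation cube_prod: product_sigma_finite "\<lambda>_. unit_interval"
  by standard

text \<open>
  The reflection \<open>v \<mapsto> x + y - v\<close> exchanges the two windows, and on the window around \<open>x\<close>
  minus the other one it increases the absolute value.
\<close>

lemma nn_integral_window_antimono:
  assumes g: "symmetric_unimodal g" and xy: "\<bar>x\<bar> \<le> \<bar>y\<bar>"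
  shows "(\<integral>\<^sup>+v. g v * indicator {y-h..y+h} v \<partial>lborel) \<le> (\<integral>\<^sup>+v. g v * indicator {x-h..x+h} v \<partial>lborel)"
proof -
  have [measurable]: "g \<in> borel_measurable borel" and
    mono: "\<bar>u\<bar> \<le> \<bar>v\<bar> \<Longrightarrow> g v \<le> g u" for u v
    using g by (auto simp: symmetric_unimodal_def)
  define J where "J z = (\<integral>\<^sup>+v. g v * indicator {z-h..z+h} v \<partial>lborel)" for z
  have J_refl: "J z = (\<integral>\<^sup>+v. g (w + z - v) * indicator {w-h..w+h} v \<partial>lborel)" for w z
  proof -
    have "J z = ennreal \<bar>-1\<bar> * (\<integral>\<^sup>+v. g ((w + z) + -1 * v) * indicator {z-h..z+h} ((w + z) + -1 * v) \<partial>lborel)"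
      unfolding J_def by (rule nn_integral_real_affine) auto
    also have "\<dots> = (\<integral>\<^sup>+v. g (w + z - v) * indicator {w-h..w+h} v \<partial>lborel)"
      by (auto intro!: nn_integral_cong simp: indicator_def)
    finally show ?thesis .
  qed
  \<comment> \<open>Taking each window integral twice, once directly and once reflected, makes the
    comparison pointwise: both sides contain the same two values of \<open>g\<close>, and only the
    indicators trade places.\<close>
  have "2 * J y = (\<integral>\<^sup>+v. g v * indicator {y-h..y+h} v + g (x + y - v) * indicator {x-h..x+h} v \<partial>lborel)"
    using J_refl[of y x] by (simp add: nn_integral_add J_def[symmetric] mult_2)
  also have "\<dots> \<le> (\<integral>\<^sup>+v. g v * indicator {x-h..x+h} v + g (x + y - v) * indicator {y-h..y+h} v \<partial>lborel)"
  proof (rule nn_integral_mono)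
    fix v
    consider "v \<in> {x-h..x+h} \<longleftrightarrow> v \<in> {y-h..y+h}" | "v \<in> {x-h..x+h}" "v \<notin> {y-h..y+h}"
      | "v \<notin> {x-h..x+h}" "v \<in> {y-h..y+h}" by blast
    then show "g v * indicator {y-h..y+h} v + g (x + y - v) * indicator {x-h..x+h} v
        \<le> g v * indicator {x-h..x+h} v + g (x + y - v) * indicator {y-h..y+h} v"
    proof cases
      case 1
      then show ?thesis by (auto simp: indicator_def)
    next
      case 2
      then have "\<bar>v\<bar> \<le> \<bar>x + y - v\<bar>"
        using xy unfolding atLeastAtMost_iff by linarith
      with 2 show ?thesis using mono by simp
    next
      case 3
      then have "\<bar>x + y - v\<bar> \<le> \<bar>v\<bar>"
        using xy unfolding atLeastAtMost_iff by linarith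
      with 3 show ?thesis using mono by simp
    qed
  qed
  also have "\<dots> = 2 * J x"
    using J_refl[of x y, unfolded add.commute[of y x]] by (simp add: nn_integral_add J_def[symmetric] mult_2)
  finally show ?thesis
    by (simp add: J_def ennreal_mult_le_mult_iff)
qed

text \<open>For a > 0 the substitution v = x + a s turns the average into 1/a times a window
  integral of half-width a/2, to which the window comparison applies.\<close>

lemma symmetric_unimodal_average:
  assumes g: "symmetric_unimodal g" and a: "0 \<le> a"
  shows "symmetric_unimodal (\<lambda>x. \<integral>\<^sup>+s. g (x + a * s) \<partial>unit_interval)"
proof (cases "a = 0")
  case True
  then show ?thesis
    using g unit_interval.emeasure_space_1 by simp
next
  case False
  then have a: "a > 0" using a by simp
  have [measurable]: "g \<in> borel_measurable borel"
    using g by (auto simp: symmetric_unimodal_def)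
  have window: "x + a * s \<in> {x-a/2..x+a/2} \<longleftrightarrow> s \<in> {-1/2..1/2}" for x s
    using mult_le_cancel_left_pos[OF a, of "-1/2" s] mult_le_cancel_left_pos[OF a, of s "1/2"] by auto
  have avg: "a * (\<integral>\<^sup>+s. g (x + a * s) \<partial>unit_interval) = (\<integral>\<^sup>+v. g v * indicator {x-a/2..x+a/2} v \<partial>lborel)" for x
  proof -
    have "(\<integral>\<^sup>+v. g v * indicator {x-a/2..x+a/2} v \<partial>lborel)
        = \<bar>a\<bar> * (\<integral>\<^sup>+s. g (x + a * s) * indicator {x-a/2..x+a/2} (x + a * s) \<partial>lborel)"
      using a by (intro nn_integral_real_affine) auto
    also have "(\<integral>\<^sup>+s. g (x + a * s) * indicator {x-a/2..x+a/2} (x + a * s) \<partial>lborel)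
        = (\<integral>\<^sup>+s. g (x + a * s) \<partial>unit_interval)"
      by (subst nn_integral_density) (auto intro!: nn_integral_cong simp: indicator_def window simp del: atLeastAtMost_iff)
    finally show ?thesis using a by simp
  qed
  show ?thesis
    unfolding symmetric_unimodal_def
  proof (intro conjI allI impI)
    show "(\<lambda>x. \<integral>\<^sup>+s. g (x + a * s) \<partial>unit_interval) \<in> borel_measurable borel"
      by (rule unit_interval.borel_measurable_nn_integral) simp
    fix x y :: real assume "\<bar>x\<bar> \<le> \<bar>y\<bar>"
    from nn_integral_window_antimono[OF g this, of "a/2"]
    show "(\<integral>\<^sup>+s. g (y + a * s) \<partial>unit_interval) \<le> (\<integral>\<^sup>+s. g (x + a * s) \<partial>unit_interval)"
      using a by (simp add: avg[symmetric] ennreal_mult_le_mult_iff)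
  qed
qed

text \<open>One coordinate is averaged out at a time. The average over the new coordinate is again
  symmetric unimodal and takes the place of \<open>g\<close>, which is why \<open>g\<close> is
  arbitrary in the induction.\<close>

lemma symmetric_unimodal_cube:
  assumes "finite I" "symmetric_unimodal g" "\<And>i. i \<in> I \<Longrightarrow> 0 \<le> a i"
  shows "symmetric_unimodal (\<lambda>x. \<integral>\<^sup>+y. g (x + (\<Sum>i\<in>I. a i * y i)) \<partial>PiM I (\<lambda>_. unit_interval))"
  using assms
proof (induction I arbitrary: g rule: finite_induct)
  case empty
  then show ?case by (simp add: PiM_empty)
next
  case (insert i I)
  have g[measurable]: "g \<in> borel_measurable borel"
    using insert.prems by (auto simp: symmetric_unimodal_def)
  define g' where "g' x = (\<integral>\<^sup>+s. g (x + a i * s) \<partial>unit_interval)" for x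
  have "(\<integral>\<^sup>+y. g (x + (\<Sum>k\<in>insert i I. a k * y k)) \<partial>PiM (insert i I) (\<lambda>_. unit_interval))
      = (\<integral>\<^sup>+y. g' (x + (\<Sum>k\<in>I. a k * y k)) \<partial>PiM I (\<lambda>_. unit_interval))" for x
  proof -
    note upd = sum_insert_update[OF insert.hyps]
    show ?thesis
      unfolding g'_def using insert.hyps
      by (subst cube_prod.product_nn_integral_insert) (auto simp: upd ac_simps)
  qed
  moreover have "symmetric_unimodal g'"
    unfolding g'_def using insert.prems by (intro symmetric_unimodal_average) auto
  ultimately show ?case
    using insert by simp
qed

lemma cube_prob_antimono:
  assumes "finite I" and "\<And>i. i \<in> I \<Longrightarrow> 0 \<le> a i"
  shows "(\<integral>\<^sup>+y. indicator {-c..c} (x + (\<Sum>i\<in>I. a i * y i)) \<partial>PiM I (\<lambda>_. unit_interval))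
      \<le> (\<integral>\<^sup>+y. indicator {-c..c} (\<Sum>i\<in>I. a i * y i) \<partial>PiM I (\<lambda>_. unit_interval))"
proof -
  have "symmetric_unimodal (indicator {-c..c})"
    by (auto simp: symmetric_unimodal_def indicator_def)
  from symmetric_unimodalD[where x = 0 and y = x, OF symmetric_unimodal_cube[OF assms(1) this assms(2)]]
  show ?thesis by simp
qed

section \<open>Gaussian averages over the cube\<close>

lemma integral_cos_unit_interval:
  "(\<integral>s. cos (x + b * s) \<partial>unit_interval) = cos x * sinc (b / 2)"
proof -
  \<comment> \<open>The general antiderivative divides by b, so b = 0 is treated apart; the result
    matches \<open>sinc 0 = 1\<close>.\<close>
  define F where "F s = (if b = 0 then cos x * s else sin (x + b * s) / b)" for s
  \<comment> \<open>A real-valued indicator is the form of density that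
    \<open>integral_density\<close> expects.\<close>
  have "unit_interval = density lborel (\<lambda>x. ennreal (indicator {-1/2..1/2} x))"
    by (simp add: ennreal_indicator)
  then have "(\<integral>s. cos (x + b * s) \<partial>unit_interval) = (\<integral>s. cos (x + b * s) * indicator {-1/2..1/2} s \<partial>lborel)"
    by (simp only:, subst integral_density) (auto simp: mult.commute)
  also have "\<dots> = F (1/2) - F (-1/2)"
  proof (rule integral_FTC_Icc_real)
    fix s
    show "DERIV F s :> cos (x + b * s)"
    proof (cases "b = 0")
      case False
      have "((\<lambda>s. sin (x + b * s)) has_real_derivative cos (x + b * s) * b) (at s)"
        by (auto intro!: derivative_eq_intros)
      from DERIV_cdivide[OF this, of b] show ?thesis
        using False unfolding F_def by simp
    next
      case True
      then show ?thesis
        unfolding F_def by (auto intro!: derivative_eq_intros)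
    qed
  qed (auto intro!: continuous_intros)
  also have "\<dots> = cos x * sinc (b / 2)"
  proof (cases "b = 0")
    case False
    have "sin (x + b * (1/2)) - sin (x + b * (-1/2)) = 2 * cos x * sin (b / 2)"
      by (simp add: sin_add sin_diff)
    then show ?thesis
      using False by (simp add: F_def diff_divide_distrib[symmetric])
  qed (simp add: F_def)
  finally show ?thesis .
qed

text \<open>The analogue of \<open>expectation_cos_signs\<close> for the uniform law, with the phase
  again free: each coordinate contributes a factor \<open>sinc\<close> and leaves cos x in
  place.\<close>

lemma integral_cos_cube:
  assumes "finite I"
  shows "(\<integral>y. cos (x + (\<Sum>k\<in>I. b k * y k)) \<partial>PiM I (\<lambda>_. unit_interval))
    = cos x * (\<Prod>k\<in>I. sinc (b k / 2))"
  using assms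
proof (induction I arbitrary: x rule: finite_induct)
  case empty
  then show ?case by (simp add: PiM_empty lebesgue_integral_count_space_finite)
next
  case (insert i I)
  let ?P = "\<lambda>I. PiM I (\<lambda>_. unit_interval)"
  note upd = sum_insert_update[OF insert.hyps]
  interpret P: prob_space "?P (insert i I)"
    by (intro prob_space_PiM prob_space_unit_interval)
  have int: "integrable (?P (insert i I)) (\<lambda>y. cos (x + (\<Sum>k\<in>insert i I. b k * y k)))"
    by (rule P.integrable_const_bound[where B = 1]) (auto simp del: sum.insert)
  have "(\<integral>y. cos (x + (\<Sum>k\<in>insert i I. b k * y k)) \<partial>?P (insert i I))
      = (\<integral>y. \<integral>s. cos (x + (\<Sum>k\<in>insert i I. b k * (y(i := s)) k)) \<partial>unit_interval \<partial>?P I)"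
    using insert.hyps int by (rule cube_prod.product_integral_insert)
  also have "\<dots> = (\<integral>y. \<integral>s. cos ((x + (\<Sum>k\<in>I. b k * y k)) + b i * s) \<partial>unit_interval \<partial>?P I)"
    by (simp only: fun_upd_apply upd add_ac)
  also have "\<dots> = cos x * (\<Prod>k\<in>I. sinc (b k / 2)) * sinc (b i / 2)"
    by (simp only: integral_cos_unit_interval insert.IH Bochner_Integration.integral_mult_left_zero)
  finally show ?case using insert.hyps by (simp add: mult_ac del: if_split_eq1)
qed

text \<open>This is the real part of the characteristic function. Read from right to left, it writes
  a Gaussian as a Gaussian average of cosines.\<close>

lemma integral_cos_std_normal:
  "(\<integral>g. cos (t * g) \<partial>std_normal_distribution) = exp (- (t\<^sup>2 / 2))"
proof -
  interpret real_distribution std_normal_distribution by (rule real_dist_normal_dist)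
  have "(\<integral>g. cos (t * g) \<partial>std_normal_distribution) = (\<integral>g. Re (iexp (t * g)) \<partial>std_normal_distribution)"
    by (simp add: Re_exp)
  also have "\<dots> = Re (char std_normal_distribution t)"
    unfolding char_def by (intro integral_Re integrable_iexp) auto
  finally show ?thesis
    by (simp add: char_std_normal_distribution)
qed

text \<open>The integrand times the standard density is a multiple of the normal density of variance
  1/(1 + q).\<close>

lemma integral_gauss_std_normal:
  assumes "0 \<le> q"
  shows "integrable std_normal_distribution (\<lambda>g. exp (- (q * g\<^sup>2 / 2)))"
    "(\<integral>g. exp (- (q * g\<^sup>2 / 2)) \<partial>std_normal_distribution) = 1 / sqrt (1 + q)"
proof -
  have "std_normal_density g * exp (- (q * g\<^sup>2 / 2)) = 1 / sqrt (1 + q) * normal_density 0 (1 / sqrt (1 + q)) g" for g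
    using assms
    by (simp add: normal_density_def power_divide real_sqrt_divide real_sqrt_mult exp_add[symmetric] field_simps)
  then have eq: "(\<lambda>g. std_normal_density g * exp (- (q * g\<^sup>2 / 2))) = (\<lambda>g. 1 / sqrt (1 + q) * normal_density 0 (1 / sqrt (1 + q)) g)"
    by auto
  have pos: "1 / sqrt (1 + q) > 0" using assms by simp
  show "integrable std_normal_distribution (\<lambda>g. exp (- (q * g\<^sup>2 / 2)))"
    using pos by (subst integrable_density) (simp_all add: eq)
  show "(\<integral>g. exp (- (q * g\<^sup>2 / 2)) \<partial>std_normal_distribution) = 1 / sqrt (1 + q)"
    using pos by (subst integral_density) (simp_all add: eq)
qed

lemma integral_pow4_std_normal:
  "integrable std_normal_distribution (\<lambda>g. g ^ 4)" "(\<integral>g. g ^ 4 \<partial>std_normal_distribution) = 3"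
  using std_normal_moment_even[of 2]
  by (auto simp: has_bochner_integral_iff integrable_density integral_density fact_numeral)

text \<open>For a standard normal G, exp (- s Y^2/2) is the mean of cos (sqrt s G Y). After
  exchanging the means, the cube yields a product of \<open>sinc (sqrt s G a_k / 2)\<close>, which
  is exp (- s G^2/24) up to (sqrt s G/2)^4 times the fourth power sum. The mean of the first is
  1/sqrt (1 + s/12); E G^4 = 3 gives the factor 3 s^2/16.\<close>

lemma integral_gauss_cube_ge:
  assumes s: "0 \<le> s" and unit: "(\<Sum>k\<in>I. (a k)\<^sup>2) = 1"
  shows "(\<integral>y. exp (- (s * (\<Sum>k\<in>I. a k * y k)\<^sup>2 / 2)) \<partial>PiM I (\<lambda>_. unit_interval))
    \<ge> 1 / sqrt (1 + s / 12) - 3 * s\<^sup>2 / 16 * (\<Sum>k\<in>I. (a k) ^ 4)"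
proof -
  let ?P = "PiM I (\<lambda>_. unit_interval)" and ?N = std_normal_distribution
  define S where "S = (\<Sum>k\<in>I. (a k) ^ 4)"
  have fin: "finite I"
    using unit by (metis sum.infinite zero_neq_one)
  interpret P: prob_space ?P
    by (intro prob_space_PiM prob_space_unit_interval)
  interpret N: prob_space ?N
    by (rule prob_space_normal_density) simp
  interpret PN: pair_prob_space ?P ?N ..
  let ?c = "\<lambda>y g. cos (sqrt s * g * (\<Sum>k\<in>I. a k * y k))"
  have meas: "(\<lambda>(y, g). ?c y g) \<in> borel_measurable (?P \<Otimes>\<^sub>M ?N)"
    by measurable
  have int: "integrable (?P \<Otimes>\<^sub>M ?N) (\<lambda>(y, g). ?c y g)"
    using meas by (intro PN.P.integrable_const_bound[where B = 1]) auto
  have prod: "(\<integral>y. ?c y g \<partial>?P) = (\<Prod>k\<in>I. sinc (sqrt s * g / 2 * a k))" for g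
    using integral_cos_cube[OF fin, of 0 "\<lambda>k. sqrt s * g * a k"]
    by (simp only: sum_distrib_left mult.assoc times_divide_eq_left cos_zero mult_1 add_0)
  have lower: "exp (- (s / 12 * g\<^sup>2 / 2)) - s\<^sup>2 / 16 * S * g ^ 4 \<le> (\<integral>y. ?c y g \<partial>?P)" for g
  proof -
    have approx: "\<bar>(\<Prod>k\<in>I. sinc (sqrt s * g / 2 * a k)) - exp (- (1/6 * (sqrt s * g / 2)\<^sup>2))\<bar>
        \<le> (sqrt s * g / 2) ^ 4 * S"
      unfolding S_def
      by (rule prod_minus_gauss_le[OF abs_sinc_le_1]) (use unit abs_sinc_minus_exp_le in \<open>auto simp del: if_split_eq1\<close>)
    have main: "1/6 * (sqrt s * g / 2)\<^sup>2 = s / 12 * g\<^sup>2 / 2"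
      using s by (simp add: power_divide power_mult_distrib)
    have err: "(sqrt s * g / 2) ^ 4 * S = s\<^sup>2 / 16 * S * g ^ 4"
    proof -
      have "sqrt s ^ 4 = ((sqrt s)\<^sup>2)\<^sup>2" by (simp flip: power_mult)
      then show ?thesis using s by (simp add: power_divide power_mult_distrib)
    qed
    have "e - r \<le> p" if "\<bar>p - e\<bar> \<le> r" for p e r :: real
      using that by linarith
    from this[OF approx[unfolded main err]] show ?thesis
      unfolding prod .
  qed
  have "1 / sqrt (1 + s / 12) - 3 * s\<^sup>2 / 16 * S
      = (\<integral>g. exp (- (s / 12 * g\<^sup>2 / 2)) - s\<^sup>2 / 16 * S * g ^ 4 \<partial>?N)"
  proof -
    have "integrable ?N (\<lambda>g. exp (- (s / 12 * g\<^sup>2 / 2)))"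
      "(\<integral>g. exp (- (s / 12 * g\<^sup>2 / 2)) \<partial>?N) = 1 / sqrt (1 + s / 12)"
      by (rule integral_gauss_std_normal; use s in simp)+
    moreover have "integrable ?N (\<lambda>g. s\<^sup>2 / 16 * S * g ^ 4)"
      "(\<integral>g. s\<^sup>2 / 16 * S * g ^ 4 \<partial>?N) = s\<^sup>2 / 16 * S * 3"
      by (rule integrable_mult_right[OF integral_pow4_std_normal(1)])
        (simp only: Bochner_Integration.integral_mult_right_zero integral_pow4_std_normal(2))
    ultimately show ?thesis
      by (simp only: Bochner_Integration.integral_diff)
  qed
  also have "\<dots> \<le> (\<integral>g. \<integral>y. ?c y g \<partial>?P \<partial>?N)"
  proof (rule integral_mono)
    show "integrable ?N (\<lambda>g. exp (- (s / 12 * g\<^sup>2 / 2)) - s\<^sup>2 / 16 * S * g ^ 4)"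
      using s by (intro Bochner_Integration.integrable_diff integral_gauss_std_normal integrable_mult_right integral_pow4_std_normal) auto
    show "integrable ?N (\<lambda>g. \<integral>y. ?c y g \<partial>?P)"
      using PN.integrable_snd[OF int] by simp
  qed (rule lower)
  also have "\<dots> = (\<integral>y. \<integral>g. ?c y g \<partial>?N \<partial>?P)"
    by (rule PN.Fubini_integral[OF int])
  also have "\<dots> = (\<integral>y. exp (- (s * (\<Sum>k\<in>I. a k * y k)\<^sup>2 / 2)) \<partial>?P)"
  proof (intro Bochner_Integration.integral_cong refl)
    fix y
    have "(\<integral>g. ?c y g \<partial>?N) = (\<integral>g. cos ((sqrt s * (\<Sum>k\<in>I. a k * y k)) * g) \<partial>?N)"
      by (simp only: mult_ac)
    also have "\<dots> = exp (- (s * (\<Sum>k\<in>I. a k * y k)\<^sup>2 / 2))"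
      using s by (simp add: integral_cos_std_normal power_mult_distrib)
    finally show "(\<integral>g. ?c y g \<partial>?N) = exp (- (s * (\<Sum>k\<in>I. a k * y k)\<^sup>2 / 2))" .
  qed
  finally show ?thesis by (simp add: S_def)
qed

text \<open>Pairing w with -w in the window gives K (w - y) + K (w + y) = K w K y (exp (s w y) + exp
  (- s w y)), at least 2 K w K y, and K w is at least K c there.\<close>

lemma gauss_window_ge:
  fixes c s y :: real
  assumes c: "0 \<le> c" and s: "0 \<le> s"
  shows "(\<integral>\<^sup>+x. ennreal (exp (- (s * x\<^sup>2 / 2))) * indicator {-c..c} (x + y) \<partial>lborel)
    \<ge> ennreal (2 * c * exp (- (s * c\<^sup>2 / 2)) * exp (- (s * y\<^sup>2 / 2)))"
proof -
  define K where "K x = exp (- (s * x\<^sup>2 / 2))" for x :: real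
  have [measurable]: "K \<in> borel_measurable borel" unfolding K_def by measurable
  define W where "W = (\<integral>\<^sup>+x. ennreal (K x) * indicator {-c..c} (x + y) \<partial>lborel)"
  \<comment> \<open>The substitution x = e w - y centres the window for either sign e; adding both
    versions produces the pairing of w with -w.\<close>
  have W: "W = (\<integral>\<^sup>+w. ennreal (K (- y + e * w)) * indicator {-c..c} w \<partial>lborel)" if "e = 1 \<or> e = -1" for e
  proof -
    have "W = \<bar>e\<bar> * (\<integral>\<^sup>+w. ennreal (K (- y + e * w)) * indicator {-c..c} ((- y + e * w) + y) \<partial>lborel)"
      unfolding W_def using that by (intro nn_integral_real_affine) auto
    also have "\<dots> = (\<integral>\<^sup>+w. ennreal (K (- y + e * w)) * indicator {-c..c} w \<partial>lborel)"
      using that by (auto intro!: nn_integral_cong simp: indicator_def)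
    finally show ?thesis .
  qed
  have K2: "2 * (K c * K y) \<le> K (- y + 1 * w) + K (- y + -1 * w)" if "w \<in> {-c..c}" for w
  proof -
    have "K w \<ge> K c"
      unfolding K_def using that s by (auto intro!: mult_left_mono simp: abs_le_square_iff[symmetric])
    then have 1: "2 * (K c * K y) \<le> K w * K y * 2"
      by (simp add: K_def mult_right_mono)
    have "2 \<le> exp z + exp (- z)" for z :: real
      using exp_ge_add_one_self[of z] exp_ge_add_one_self[of "-z"] by linarith
    then have "K w * K y * 2 \<le> K w * K y * (exp (s * w * y) + exp (- (s * w * y)))"
      by (intro mult_left_mono) (auto simp: K_def)
    also have "\<dots> = K (- y + 1 * w) + K (- y + -1 * w)"
      by (simp add: K_def distrib_left exp_add[symmetric] power2_eq_square algebra_simps add_divide_distrib diff_divide_distrib)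
    finally show ?thesis using 1 by linarith
  qed
  have "2 * ennreal (2 * c * K c * K y) = (\<integral>\<^sup>+w. ennreal (2 * (K c * K y)) * indicator {-c..c} w \<partial>lborel)"
    using c by (subst nn_integral_cmult_indicator)
      (auto simp: ennreal_mult'[symmetric] mult_ac K_def simp flip: ennreal_numeral)
  also have "\<dots> \<le> (\<integral>\<^sup>+w. ennreal (K (- y + 1 * w)) * indicator {-c..c} w
      + ennreal (K (- y + -1 * w)) * indicator {-c..c} w \<partial>lborel)"
    using K2 by (intro nn_integral_mono) (auto simp: indicator_def K_def ennreal_plus[symmetric] simp del: ennreal_plus)
  also have "\<dots> = 2 * W"
    using W[of 1] W[of "-1"] by (simp add: nn_integral_add mult_2)
  finally show ?thesis
    by (simp add: W_def K_def ennreal_mult_le_mult_iff)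
qed

lemma nn_integral_gauss:
  assumes "0 < s"
  shows "(\<integral>\<^sup>+x. ennreal (exp (- (s * x\<^sup>2 / 2))) \<partial>lborel) = ennreal (sqrt (2 * pi / s))"
proof -
  have s: "0 < 1 / sqrt s" using assms by simp
  have "exp (- (s * x\<^sup>2 / 2)) = sqrt (2 * pi / s) * normal_density 0 (1 / sqrt s) x" for x
    using assms by (simp add: normal_density_def power_divide real_sqrt_divide real_sqrt_mult)
  moreover have "(\<integral>\<^sup>+x. ennreal (normal_density 0 (1 / sqrt s) x) \<partial>lborel) = 1"
    using s by (subst nn_integral_eq_integral) auto
  ultimately show ?thesis
    using assms by (simp add: ennreal_mult' nn_integral_cmult)
qed

text \<open>For each value of the sum, \<open>gauss_window_ge\<close> bounds the Gaussian average
  over shifts of the window from below. After exchanging the integrals,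
  \<open>cube_prob_antimono\<close> replaces every shift by 0, and the Gaussian weight integrates to
  sqrt (2 pi/s).\<close>

lemma cube_window_ge:
  assumes c: "0 \<le> c" and s: "0 < s" and I: "finite I" and a: "\<And>i. i \<in> I \<Longrightarrow> 0 \<le> a i"
  shows "ennreal (2 * c * exp (- (s * c\<^sup>2 / 2))
      * (\<integral>y. exp (- (s * (\<Sum>k\<in>I. a k * y k)\<^sup>2 / 2)) \<partial>PiM I (\<lambda>_. unit_interval)))
    \<le> ennreal (sqrt (2 * pi / s)) * (\<integral>\<^sup>+y. indicator {-c..c} (\<Sum>k\<in>I. a k * y k) \<partial>PiM I (\<lambda>_. unit_interval))"
proof -
  let ?P = "PiM I (\<lambda>_. unit_interval)"
  let ?Y = "\<lambda>y. \<Sum>k\<in>I. a k * y k"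
  let ?K = "\<lambda>x :: real. exp (- (s * x\<^sup>2 / 2))"
  interpret P: prob_space ?P
    by (intro prob_space_PiM prob_space_unit_interval)
  interpret pair_sigma_finite lborel ?P ..
  have int: "integrable ?P (\<lambda>y. ?K (?Y y))"
    using s by (intro P.integrable_const_bound[where B = 1]) auto
  have "ennreal (2 * c * exp (- (s * c\<^sup>2 / 2)) * (\<integral>y. ?K (?Y y) \<partial>?P))
      = (\<integral>\<^sup>+y. ennreal (2 * c * exp (- (s * c\<^sup>2 / 2)) * ?K (?Y y)) \<partial>?P)"
    using int c by (subst nn_integral_eq_integral) auto
  also have "\<dots> \<le> (\<integral>\<^sup>+y. \<integral>\<^sup>+x. ennreal (?K x) * indicator {-c..c} (x + ?Y y) \<partial>lborel \<partial>?P)"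
    using c s by (intro nn_integral_mono gauss_window_ge) auto
  also have "\<dots> = (\<integral>\<^sup>+x. \<integral>\<^sup>+y. ennreal (?K x) * indicator {-c..c} (x + ?Y y) \<partial>?P \<partial>lborel)"
    by (rule Fubini') measurable
  also have "\<dots> = (\<integral>\<^sup>+x. ennreal (?K x) * (\<integral>\<^sup>+y. indicator {-c..c} (x + ?Y y) \<partial>?P) \<partial>lborel)"
    by (intro nn_integral_cong nn_integral_cmult) measurable
  also have "\<dots> \<le> (\<integral>\<^sup>+x. ennreal (?K x) * (\<integral>\<^sup>+y. indicator {-c..c} (?Y y) \<partial>?P) \<partial>lborel)"
    by (intro nn_integral_mono mult_left_mono cube_prob_antimono I a) auto
  also have "\<dots> = ennreal (sqrt (2 * pi / s)) * (\<integral>\<^sup>+y. indicator {-c..c} (?Y y) \<partial>?P)"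
    using s by (simp add: nn_integral_multc nn_integral_gauss)
  finally show ?thesis .
qed

section \<open>Lebesgue measure under affine and orthogonal maps\<close>

abbreviation lebesgue_PiM :: "'i set \<Rightarrow> ('i \<Rightarrow> real) measure" where
  "lebesgue_PiM I \<equiv> PiM I (\<lambda>_. lborel)"

interpretation lborel_prod: product_sigma_finite "\<lambda>_. lborel :: real measure"
  by standard

text \<open>A product measure is determined on boxes, where each coordinate obeys the
  one-dimensional rule. Translations, reflections and dilations are all instances needed
  below.\<close>

lemma PiM_lborel_affine:
  fixes t :: "'i \<Rightarrow> real"
  assumes I: "finite I" and c: "c \<noteq> 0"
  shows "density (distr (lebesgue_PiM I) (lebesgue_PiM I) (\<lambda>x. \<lambda>i\<in>I. t i + c * x i))
           (\<lambda>_. ennreal \<bar>c\<bar> ^ card I) = lebesgue_PiM I"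
proof (rule lborel_prod.PiM_eqI[OF I])
  fix A :: "'i \<Rightarrow> real set"
  assume A: "\<And>i. i \<in> I \<Longrightarrow> A i \<in> sets lborel"
  let ?g = "\<lambda>x. \<lambda>i\<in>I. t i + c * x i"
  have g: "?g \<in> measurable (lebesgue_PiM I) (lebesgue_PiM I)"
    by measurable
  have box: "PiE I A \<in> sets (lebesgue_PiM I)"
    using I A by (rule sets_PiM_I_finite)
  have one: "\<bar>c\<bar> * emeasure lborel ((\<lambda>x. t i + c * x) -` A i) = emeasure lborel (A i)" if "i \<in> I" for i
  proof -
    have "emeasure lborel (A i)
        = emeasure (density (distr lborel borel (\<lambda>x. t i + c * x)) (\<lambda>_. ennreal (abs c))) (A i)"
      using lborel_real_affine[OF c, of "t i"] by simp
    also have "\<dots> = \<bar>c\<bar> * emeasure lborel ((\<lambda>x. t i + c * x) -` A i)"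
      using A[OF that] by (simp add: emeasure_density_const emeasure_distr)
    finally show ?thesis ..
  qed
  have "?g -` PiE I A \<inter> space (lebesgue_PiM I) = PiE I (\<lambda>i. (\<lambda>x. t i + c * x) -` A i)"
    by (auto simp: space_PiM PiE_iff)
  then have "emeasure (density (distr (lebesgue_PiM I) (lebesgue_PiM I) ?g) (\<lambda>_. ennreal \<bar>c\<bar> ^ card I)) (PiE I A)
     = ennreal \<bar>c\<bar> ^ card I * emeasure (lebesgue_PiM I) (PiE I (\<lambda>i. (\<lambda>x. t i + c * x) -` A i))"
    using g box by (simp add: emeasure_density_const emeasure_distr)
  also have "\<dots> = ennreal \<bar>c\<bar> ^ card I * (\<Prod>i\<in>I. emeasure lborel ((\<lambda>x. t i + c * x) -` A i))"
  proof (subst lborel_prod.emeasure_PiM[OF I])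
    fix i assume "i \<in> I"
    have "(\<lambda>x. t i + c * x) \<in> measurable borel borel" by measurable
    from measurable_sets[OF this, of "A i"] A[OF \<open>i \<in> I\<close>]
    show "(\<lambda>x. t i + c * x) -` A i \<in> sets lborel" by simp
  qed simp
  also have "\<dots> = (\<Prod>i\<in>I. emeasure lborel (A i))"
    by (simp add: one[symmetric] prod.distrib)
  finally show "emeasure (density (distr (lebesgue_PiM I) (lebesgue_PiM I) ?g) (\<lambda>_. ennreal \<bar>c\<bar> ^ card I)) (PiE I A)
     = (\<Prod>i\<in>I. emeasure lborel (A i))" .
qed simp

lemma nn_integral_PiM_lborel_affine:
  fixes t :: "'i \<Rightarrow> real"
  assumes I: "finite I" and c: "c \<noteq> 0" and f[measurable]: "f \<in> borel_measurable (lebesgue_PiM I)"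
  shows "(\<integral>\<^sup>+x. f x \<partial>lebesgue_PiM I)
    = ennreal \<bar>c\<bar> ^ card I * (\<integral>\<^sup>+x. f (\<lambda>i\<in>I. t i + c * x i) \<partial>lebesgue_PiM I)"
  by (subst PiM_lborel_affine[OF I c, of t, symmetric])
    (simp add: nn_integral_density nn_integral_distr nn_integral_cmult)

text \<open>
  The vectors \<open>w i\<close> below are the residues of the unit vectors. Their squared norms are
  \<open>1 - (\<Sum>j. (v j i)\<^sup>2)\<close>, and these sum to zero.
\<close>

lemma orthonormal_rows_imp_columns:
  fixes v :: "'i \<Rightarrow> 'i \<Rightarrow> real"
  assumes I: "finite I"
    and orth: "\<And>j k. j \<in> I \<Longrightarrow> k \<in> I \<Longrightarrow> (\<Sum>i\<in>I. v j i * v k i) = of_bool (j = k)"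
    and ik: "i \<in> I" "k \<in> I"
  shows "(\<Sum>j\<in>I. v j i * v j k) = of_bool (i = k)"
proof -
  define w where "w i k = of_bool (i = k) - (\<Sum>j\<in>I. v j i * v j k)" for i k
  have norm_w: "(\<Sum>k\<in>I. (w i k)\<^sup>2) = 1 - (\<Sum>j\<in>I. (v j i)\<^sup>2)" if i: "i \<in> I" for i
  proof -
    have "(\<Sum>k\<in>I. (\<Sum>j\<in>I. v j i * v j k)\<^sup>2) = (\<Sum>k\<in>I. \<Sum>j\<in>I. \<Sum>l\<in>I. v j i * v l i * (v j k * v l k))"
      by (simp add: power2_eq_square sum_product mult_ac)
    also have "\<dots> = (\<Sum>j\<in>I. \<Sum>l\<in>I. \<Sum>k\<in>I. v j i * v l i * (v j k * v l k))"
      by (rule trans[OF sum.swap]) (rule sum.cong[OF refl], rule sum.swap)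
    also have "\<dots> = (\<Sum>j\<in>I. \<Sum>l\<in>I. v j i * v l i * of_bool (j = l))"
      by (intro sum.cong refl) (simp add: sum_distrib_left[symmetric] orth)
    also have "\<dots> = (\<Sum>j\<in>I. (v j i)\<^sup>2)"
      using I by (simp add: of_bool_def if_distrib sum.delta' power2_eq_square cong: if_cong)
    finally have sq: "(\<Sum>k\<in>I. (\<Sum>j\<in>I. v j i * v j k)\<^sup>2) = (\<Sum>j\<in>I. (v j i)\<^sup>2)" .
    have "(\<Sum>k\<in>I. (w i k)\<^sup>2) = (\<Sum>k\<in>I. (if i = k then 1 - 2 * (\<Sum>j\<in>I. v j i * v j k) else 0)
        + (\<Sum>j\<in>I. v j i * v j k)\<^sup>2)"
      by (intro sum.cong) (auto simp: w_def power2_eq_square algebra_simps)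
    also have "\<dots> = 1 - 2 * (\<Sum>j\<in>I. (v j i)\<^sup>2) + (\<Sum>j\<in>I. (v j i)\<^sup>2)"
      using I i by (simp add: sum.distrib sq) (simp add: power2_eq_square)
    finally show ?thesis by simp
  qed
  have "(\<Sum>i\<in>I. \<Sum>k\<in>I. (w i k)\<^sup>2) = real (card I) - (\<Sum>i\<in>I. \<Sum>j\<in>I. (v j i)\<^sup>2)"
    by (simp add: norm_w sum_subtractf)
  also have "(\<Sum>i\<in>I. \<Sum>j\<in>I. (v j i)\<^sup>2) = (\<Sum>j\<in>I. \<Sum>i\<in>I. v j i * v j i)"
    by (subst sum.swap) (simp add: power2_eq_square)
  also have "\<dots> = real (card I)"
    by (simp add: orth)
  finally have "(\<Sum>i\<in>I. \<Sum>k\<in>I. (w i k)\<^sup>2) = 0" by simp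
  then have "(w i k)\<^sup>2 = 0"
    using I ik by (simp add: sum_nonneg_eq_0_iff sum_nonneg)
  then show ?thesis by (simp add: w_def)
qed

text \<open>
  Both sides of \<open>proportional\<close> are a double integral over \<open>x\<close> and \<open>y\<close>: the image
  measure inherits translation invariance, so it is proportional to Lebesgue measure. The
  unit ball is its own image, which makes the factor one.
\<close>

lemma nn_integral_orthogonal_image:
  fixes v :: "'i \<Rightarrow> 'i \<Rightarrow> real"
  assumes I: "finite I"
    and orth: "\<And>j k. j \<in> I \<Longrightarrow> k \<in> I \<Longrightarrow> (\<Sum>i\<in>I. v j i * v k i) = of_bool (j = k)"
    and B[measurable]: "B \<in> sets (lebesgue_PiM I)"
  shows "(\<integral>\<^sup>+t. indicator B (\<lambda>i\<in>I. \<Sum>j\<in>I. t j * v j i) \<partial>lebesgue_PiM I) = emeasure (lebesgue_PiM I) B"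
proof -
  let ?M = "lebesgue_PiM I"
  define L where "L t = (\<lambda>i\<in>I. \<Sum>j\<in>I. t j * v j i)" for t :: "'i \<Rightarrow> real"
  have L[measurable]: "L \<in> measurable ?M ?M"
    unfolding L_def by measurable
  have L_coord: "(\<Sum>i\<in>I. L t i * v k i) = t k" if k: "k \<in> I" for t k
  proof -
    have "(\<Sum>i\<in>I. L t i * v k i) = (\<Sum>i\<in>I. \<Sum>j\<in>I. t j * (v j i * v k i))"
      by (simp add: L_def sum_distrib_right mult.assoc)
    also have "\<dots> = (\<Sum>j\<in>I. t j * of_bool (j = k))"
      by (subst sum.swap) (simp add: sum_distrib_left[symmetric] orth k)
    also have "\<dots> = t k"
      using I k by (simp add: of_bool_def if_distrib sum.delta cong: if_cong)
    finally show ?thesis .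
  qed
  have L_norm: "(\<Sum>i\<in>I. (L t i)\<^sup>2) = (\<Sum>j\<in>I. (t j)\<^sup>2)" for t
  proof -
    have "(\<Sum>i\<in>I. (L t i)\<^sup>2) = (\<Sum>i\<in>I. \<Sum>j\<in>I. t j * (L t i * v j i))"
      by (intro sum.cong refl) (simp add: power2_eq_square, subst (2) L_def, simp add: sum_distrib_left mult_ac)
    also have "\<dots> = (\<Sum>j\<in>I. t j * t j)"
      by (subst sum.swap) (simp add: sum_distrib_left[symmetric] L_coord)
    finally show ?thesis by (simp add: power2_eq_square)
  qed
  \<comment> \<open>These are the coordinates of \<open>y\<close> with respect to the rows
    \<open>v j\<close>. By orthonormality of the columns, \<open>L\<close> carries them back to
    \<open>y\<close>, so a translation of the image is a translation of the parameter.\<close>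
  define y' where "y' y j = (\<Sum>k\<in>I. y k * v j k)" for y j
  have L_shift: "L (\<lambda>j\<in>I. y' y j + 1 * x j) = (\<lambda>i\<in>I. y i + L x i)" for x y
  proof
    fix i show "L (\<lambda>j\<in>I. y' y j + 1 * x j) i = (\<lambda>i\<in>I. y i + L x i) i"
    proof (cases "i \<in> I")
      case True
      have "(\<Sum>j\<in>I. y' y j * v j i) = (\<Sum>k\<in>I. \<Sum>j\<in>I. y k * (v j k * v j i))"
        unfolding y'_def sum_distrib_right by (subst sum.swap) (simp add: mult.assoc)
      also have "\<dots> = (\<Sum>k\<in>I. y k * of_bool (k = i))"
        by (intro sum.cong refl)
          (simp add: sum_distrib_left[symmetric] orthonormal_rows_imp_columns[OF I orth] True)
      also have "\<dots> = y i"
        using I True by (simp add: of_bool_def if_distrib sum.delta cong: if_cong)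
      finally show ?thesis
        using True by (simp add: L_def distrib_right sum.distrib)
    qed (simp add: L_def)
  qed
  interpret sigma_finite_measure ?M
    by (rule lborel_prod.sigma_finite[OF I])
  interpret pair_sigma_finite ?M ?M ..
  have proportional: "(\<integral>\<^sup>+x. indicator A (L x) \<partial>?M) * emeasure ?M B = (\<integral>\<^sup>+x. indicator B (L x) \<partial>?M) * emeasure ?M A"
    if A[measurable]: "A \<in> sets ?M" for A
  proof -
    have [measurable]: "(\<lambda>p. fst p i) \<in> borel_measurable (?M \<Otimes>\<^sub>M ?M)"
      "(\<lambda>p. snd p i) \<in> borel_measurable (?M \<Otimes>\<^sub>M ?M)" if "i \<in> I" for i
      using measurable_compose[OF measurable_fst measurable_component_singleton[OF that, of "\<lambda>_. lborel"]]
        measurable_compose[OF measurable_snd measurable_component_singleton[OF that, of "\<lambda>_. lborel"]]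
      by simp_all
    have "(\<lambda>p. \<lambda>i\<in>I. (\<Sum>j\<in>I. fst p j * v j i) + c * snd p i) \<in> measurable (?M \<Otimes>\<^sub>M ?M) ?M" for c :: real
      by (rule measurable_restrict) (simp, measurable)
    then have meas: "(\<lambda>p. \<lambda>i\<in>I. L (fst p) i + c * snd p i) \<in> measurable (?M \<Otimes>\<^sub>M ?M) ?M" for c :: real
      by (simp add: L_def cong: restrict_cong)
    then have meas2: "(\<lambda>p. \<lambda>i\<in>I. snd p i + L (fst p) i) \<in> measurable (?M \<Otimes>\<^sub>M ?M) ?M"
      using meas[of 1] by (simp add: add.commute)
    note [measurable] = meas meas2
    have affine: "(\<integral>\<^sup>+y. f (\<lambda>i\<in>I. t i + c * y i) \<partial>?M) = (\<integral>\<^sup>+y. f y \<partial>?M)"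
      if "\<bar>c\<bar> = 1" "f \<in> borel_measurable ?M" for f :: "('i \<Rightarrow> real) \<Rightarrow> ennreal" and t c
      using nn_integral_PiM_lborel_affine[OF I _ that(2), of c t] that(1) by force
    have "(\<integral>\<^sup>+x. indicator A (L x) \<partial>?M) * emeasure ?M B
        = (\<integral>\<^sup>+x. indicator A (L x) * (\<integral>\<^sup>+y. indicator B (\<lambda>i\<in>I. L x i + 1 * y i) \<partial>?M) \<partial>?M)"
      by (subst affine) (simp_all add: nn_integral_multc)
    also have "\<dots> = (\<integral>\<^sup>+x. \<integral>\<^sup>+y. indicator A (L x) * indicator B (\<lambda>i\<in>I. y i + L x i) \<partial>?M \<partial>?M)"
      by (simp add: nn_integral_cmult add.commute)
    also have "\<dots> = (\<integral>\<^sup>+y. \<integral>\<^sup>+x. indicator A (L x) * indicator B (\<lambda>i\<in>I. y i + L x i) \<partial>?M \<partial>?M)"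
      by (rule Fubini'[symmetric]) measurable
    \<comment> \<open>For fixed \<open>y\<close>, shifting the parameter by \<open>y' y\<close>
      moves the translation from the argument of \<open>B\<close> to that of \<open>A\<close>, with
      the opposite sign.\<close>
    also have "\<dots> = (\<integral>\<^sup>+y. \<integral>\<^sup>+x. indicator A (\<lambda>i\<in>I. L x i + (-1) * y i) * indicator B (L x) \<partial>?M \<partial>?M)"
    proof (rule nn_integral_cong)
      fix y
      have "(\<lambda>x. L x i) \<in> borel_measurable ?M" if "i \<in> I" for i
        using measurable_compose[OF L measurable_component_singleton[OF that]] by simp
      then have [measurable]: "(\<lambda>x. \<lambda>i\<in>I. L x i + (-1) * y i) \<in> measurable ?M ?M"
        by (intro measurable_restrict) simp
      have "(\<integral>\<^sup>+x. indicator A (\<lambda>i\<in>I. L x i + (-1) * y i) * indicator B (L x) \<partial>?M)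
          = (\<integral>\<^sup>+x. indicator A (\<lambda>i\<in>I. L (\<lambda>j\<in>I. y' y j + 1 * x j) i + (-1) * y i)
               * indicator B (L (\<lambda>j\<in>I. y' y j + 1 * x j)) \<partial>?M)"
        by (rule affine[symmetric, where f = "\<lambda>x. indicator A (\<lambda>i\<in>I. L x i + (-1) * y i) * indicator B (L x)"]) (simp, measurable)
      also have "\<dots> = (\<integral>\<^sup>+x. indicator A (L x) * indicator B (\<lambda>i\<in>I. y i + L x i) \<partial>?M)"
      proof (rule nn_integral_cong)
        fix x
        have "(\<lambda>i\<in>I. (\<lambda>i\<in>I. y i + L x i) i + (-1) * y i) = L x"
          by (auto simp: L_def fun_eq_iff)
        then show "indicator A (\<lambda>i\<in>I. L (\<lambda>j\<in>I. y' y j + 1 * x j) i + (-1) * y i)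
               * indicator B (L (\<lambda>j\<in>I. y' y j + 1 * x j))
            = (indicator A (L x) * indicator B (\<lambda>i\<in>I. y i + L x i) :: ennreal)"
          unfolding L_shift by simp
      qed
      finally show "(\<integral>\<^sup>+x. indicator A (L x) * indicator B (\<lambda>i\<in>I. y i + L x i) \<partial>?M)
          = (\<integral>\<^sup>+x. indicator A (\<lambda>i\<in>I. L x i + (-1) * y i) * indicator B (L x) \<partial>?M)" ..
    qed
    also have "\<dots> = (\<integral>\<^sup>+x. \<integral>\<^sup>+y. indicator A (\<lambda>i\<in>I. L x i + (-1) * y i) * indicator B (L x) \<partial>?M \<partial>?M)"
      by (rule Fubini') measurable
    also have "\<dots> = (\<integral>\<^sup>+x. (\<integral>\<^sup>+y. indicator A (\<lambda>i\<in>I. L x i + (-1) * y i) \<partial>?M) * indicator B (L x) \<partial>?M)"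
      by (intro nn_integral_cong nn_integral_multc) measurable
    also have "\<dots> = (\<integral>\<^sup>+x. indicator B (L x) \<partial>?M) * emeasure ?M A"
      by (subst affine) (simp_all add: nn_integral_cmult mult.commute[of _ "emeasure ?M A"])
    finally show ?thesis .
  qed
  define A where "A = {x \<in> space ?M. (\<Sum>i\<in>I. (x i)\<^sup>2) \<le> 1}"
  have A: "A \<in> sets ?M"
    unfolding A_def by measurable
  have "(\<integral>\<^sup>+x. indicator A (L x) \<partial>?M) = (\<integral>\<^sup>+x. indicator A x \<partial>?M)"
  proof (rule nn_integral_cong)
    fix x assume "x \<in> space ?M"
    moreover from this have "L x \<in> space ?M" using measurable_space[OF L] by simp
    ultimately show "indicator A (L x) = (indicator A x :: ennreal)"
      by (simp add: A_def L_norm indicator_def)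
  qed
  then have LA: "(\<integral>\<^sup>+x. indicator A (L x) \<partial>?M) = emeasure ?M A"
    using A by simp
  \<comment> \<open>Cancelling the ball's measure requires it to be finite and nonzero, shown by a
    box around the ball and a box inside it.\<close>
  have "emeasure ?M A \<le> emeasure ?M (PiE I (\<lambda>_. {-1..1}))"
  proof (rule emeasure_mono)
    show "A \<subseteq> PiE I (\<lambda>_. {-1..1})"
    proof
      fix x assume x: "x \<in> A"
      have "\<bar>x i\<bar> \<le> 1" if i: "i \<in> I" for i
      proof -
        have "(x i)\<^sup>2 \<le> (\<Sum>i\<in>I. (x i)\<^sup>2)"
          by (rule member_le_sum) (use i I in auto)
        then have "(x i)\<^sup>2 \<le> 1" using x by (simp add: A_def)
        then show ?thesis by (simp add: abs_square_le_1)
      qed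
      then show "x \<in> PiE I (\<lambda>_. {-1..1})"
        using x by (force simp: A_def space_PiM PiE_iff abs_le_iff)
    qed
    show "PiE I (\<lambda>_. {-1..1}) \<in> sets ?M"
      using I by (intro sets_PiM_I_finite) auto
  qed
  also have "\<dots> < \<infinity>"
    using I by (simp add: lborel_prod.emeasure_PiM power_less_top_ennreal)
  finally have A_fin: "emeasure ?M A \<noteq> \<infinity>" by simp
  \<comment> \<open>This side length gives card I * r^2 \<le> 1, so the box lies in the ball; the
    added 1 keeps \<open>r\<close> meaningful for empty \<open>I\<close>.\<close>
  define r where "r = 1 / (1 + real (card I))"
  have r: "0 < r" "r \<le> 1" "real (card I) * r \<le> 1" by (auto simp: r_def field_simps)
  have "0 < emeasure ?M (PiE I (\<lambda>_. {0..r}))"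
    using I r by (simp add: lborel_prod.emeasure_PiM ennreal_power)
  also have "\<dots> \<le> emeasure ?M A"
  proof (rule emeasure_mono[OF _ A])
    show "PiE I (\<lambda>_. {0..r}) \<subseteq> A"
    proof
      fix x assume x: "x \<in> PiE I (\<lambda>_. {0..r})"
      have "(\<Sum>i\<in>I. (x i)\<^sup>2) \<le> (\<Sum>i\<in>I. r\<^sup>2)"
        using x by (intro sum_mono power_mono) auto
      also have "\<dots> = (real (card I) * r) * r" by (simp add: power2_eq_square)
      also have "\<dots> \<le> 1 * 1" using r by (intro mult_mono) auto
      finally show "x \<in> A" using x by (auto simp: A_def space_PiM)
    qed
  qed
  finally have A_pos: "emeasure ?M A \<noteq> 0" by simp
  have "emeasure ?M A * emeasure ?M B = emeasure ?M A * (\<integral>\<^sup>+x. indicator B (L x) \<partial>?M)"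
    using proportional[OF A] by (simp add: LA mult.commute)
  then have "emeasure ?M B = (\<integral>\<^sup>+x. indicator B (L x) \<partial>?M)"
    using A_pos A_fin by (simp add: ennreal_mult_cancel_left)
  then show ?thesis by (simp add: L_def)
qed

section \<open>Slabs and the central section\<close>

text \<open>Agreement on boxes suffices. This links the probabilistic cube used so far with Lebesgue
  measure restricted to \<open>cube n\<close>.\<close>

lemma PiM_unit_interval_eq_density:
  assumes I: "finite I"
  shows "PiM I (\<lambda>_. unit_interval) = density (lebesgue_PiM I) (indicator (PiE I (\<lambda>_. {-1/2..1/2})))"
proof (rule cube_prod.PiM_eqI[OF I, symmetric])
  fix A :: "'a \<Rightarrow> real set"
  assume A: "\<And>i. i \<in> I \<Longrightarrow> A i \<in> sets unit_interval"
  let ?Q = "PiE I (\<lambda>_. {-1/2..1/2::real})"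
  have Q: "?Q \<in> sets (lebesgue_PiM I)" and A': "PiE I A \<in> sets (lebesgue_PiM I)"
    using I A by (auto intro!: sets_PiM_I_finite)
  have "emeasure (density (lebesgue_PiM I) (indicator ?Q)) (PiE I A)
      = (\<integral>\<^sup>+x. indicator (?Q \<inter> PiE I A) x \<partial>lebesgue_PiM I)"
    using Q A' by (simp add: emeasure_density indicator_inter_arith)
  also have "\<dots> = emeasure (lebesgue_PiM I) (?Q \<inter> PiE I A)"
    using Q A' by simp
  also have "?Q \<inter> PiE I A = PiE I (\<lambda>i. {-1/2..1/2} \<inter> A i)"
    by (rule PiE_Int)
  also have "emeasure (lebesgue_PiM I) \<dots> = (\<Prod>i\<in>I. emeasure lborel ({-1/2..1/2} \<inter> A i))"
    using I A by (intro lborel_prod.emeasure_PiM) auto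
  also have "\<dots> = (\<Prod>i\<in>I. emeasure unit_interval (A i))"
  proof (rule prod.cong)
    fix i assume "i \<in> I"
    then have "A i \<in> sets borel" using A by simp
    then have "emeasure unit_interval (A i) = (\<integral>\<^sup>+x. indicator ({-1/2..1/2} \<inter> A i) x \<partial>lborel)"
      by (simp add: emeasure_density indicator_inter_arith)
    with \<open>A i \<in> sets borel\<close> show "emeasure lborel ({-1/2..1/2} \<inter> A i) = emeasure unit_interval (A i)"
      by simp
  qed simp
  finally show "emeasure (density (lebesgue_PiM I) (indicator ?Q)) (PiE I A) = (\<Prod>i\<in>I. emeasure unit_interval (A i))" .
next
  show "sets (density (lebesgue_PiM I) (indicator (PiE I (\<lambda>_. {-1/2..1/2})))) = sets (PiM I (\<lambda>_. unit_interval))"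
    unfolding sets_density by (rule sets_PiM_cong) auto
qed

lemma dotp_commute: "dotp n x y = dotp n y x"
  by (simp add: dotp_def mult.commute)

lemma dotp_chart:
  "dotp n w (chart n a r u t) = r * dotp n w a + (\<Sum>j=1..n-1. t j * dotp n w (u j))"
proof -
  have "dotp n w (chart n a r u t) = (\<Sum>i=1..n. r * (w i * a i) + (\<Sum>j=1..n-1. t j * (w i * u j i)))"
    unfolding dotp_def chart_def by (intro sum.cong) (auto simp: distrib_left sum_distrib_left mult_ac)
  also have "\<dots> = r * dotp n w a + (\<Sum>i=1..n. \<Sum>j=1..n-1. t j * (w i * u j i))"
    by (simp add: sum.distrib dotp_def sum_distrib_left)
  also have "(\<Sum>i=1..n. \<Sum>j=1..n-1. t j * (w i * u j i)) = (\<Sum>j=1..n-1. \<Sum>i=1..n. t j * (w i * u j i))"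
    by (rule sum.swap)
  finally show ?thesis by (simp add: dotp_def sum_distrib_left)
qed

text \<open>At height 0 the chart always lands in the hyperplane, so intersecting with it changes
  nothing. The basis selected by \<open>SOME\<close> is named here once and for all.\<close>

lemma section_vol_0_eq:
  assumes unit: "(\<Sum>j=1..n. (a j)\<^sup>2) = 1"
  obtains u where "orthonormal_basis n a u"
    "section_vol n a 0 = measure (lebesgue_PiM {1..n-1}) {t \<in> euclid (n-1). chart n a 0 u t \<in> cube n}"
proof
  define u where "u = (SOME u. orthonormal_basis n a u)"
  show u: "orthonormal_basis n a u"
    unfolding u_def using ex_orthonormal_basis[OF unit] by (rule someI_ex)
  have "chart n a 0 u t \<in> shifted_hyperplane n a 0" for t
  proof -
    have "dotp n a (chart n a 0 u t) = 0"
      using u by (subst dotp_chart) (auto simp: orthonormal_basis_def hyperplane_def intro!: sum.neutral)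
    then have h: "chart n a 0 u t \<in> hyperplane n a"
      by (simp add: hyperplane_def euclid_def chart_def)
    have eq: "chart n a 0 u t = (\<lambda>i\<in>{1..n}. chart n a 0 u t i + 0 * a i)"
      by (auto simp: chart_def)
    show ?thesis
      unfolding shifted_hyperplane_def
      by (rule image_eqI[where f = "\<lambda>h. \<lambda>i\<in>{1..n}. h i + 0 * a i", OF eq h])
  qed
  then show "section_vol n a 0 = measure (lebesgue_PiM {1..n-1}) {t \<in> euclid (n-1). chart n a 0 u t \<in> cube n}"
    by (simp add: section_vol_def hyperplane_vol_def u_def Let_def)
qed

text \<open>Each parameter t_j is the inner product of \<open>u j\<close> with the chart point; all
  entries of both are at most 1 in modulus, so |t_j| \<le> n. Finiteness matters because
  \<open>measure\<close> assigns 0 to sets of infinite measure.\<close>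

lemma emeasure_central_section_finite:
  assumes u: "orthonormal_basis n a u"
  defines "C \<equiv> {t \<in> euclid (n-1). chart n a 0 u t \<in> cube n}"
  shows "C \<in> sets (lebesgue_PiM {1..n-1})" "emeasure (lebesgue_PiM {1..n-1}) C < \<infinity>"
proof -
  let ?N = "lebesgue_PiM {1..n-1}" and ?M = "lebesgue_PiM {1..n}"
  have chart: "chart n a 0 u \<in> measurable ?N ?M"
    unfolding chart_def by measurable
  have "cube n \<in> sets ?M"
    unfolding cube_def by (intro sets_PiM_I_finite) auto
  from measurable_sets[OF chart this] show C: "C \<in> sets ?N"
    by (simp add: C_def euclid_def space_PiM vimage_def Int_def conj_commute)
  have box: "C \<subseteq> PiE {1..n-1} (\<lambda>_. {- real n..real n})"
  proof
    fix t assume t: "t \<in> C"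
    have "\<bar>t j\<bar> \<le> real n" if j: "j \<in> {1..n-1}" for j
    proof -
      have "dotp n (u j) (chart n a 0 u t) = (\<Sum>k=1..n-1. t k * dotp n (u j) (u k))"
        by (subst dotp_chart) simp
      also have "\<dots> = (\<Sum>k=1..n-1. if k = j then t k else 0)"
        by (rule sum.cong) (use u j in \<open>auto simp: orthonormal_basis_def\<close>)
      also have "\<dots> = t j"
        using j by simp
      finally have "\<bar>t j\<bar> \<le> (\<Sum>i=1..n. \<bar>u j i * chart n a 0 u t i\<bar>)"
        unfolding dotp_def using sum_abs[of "\<lambda>i. u j i * chart n a 0 u t i" "{1..n}"] by simp
      also have "\<dots> \<le> (\<Sum>i=1..n. 1)"
      proof (rule sum_mono)
        fix i assume i: "i \<in> {1..n}"
        have "(u j i)\<^sup>2 \<le> (\<Sum>i=1..n. (u j i)\<^sup>2)"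
          by (rule member_le_sum) (use i in auto)
        also have "\<dots> = 1"
          using u j by (simp add: orthonormal_basis_def dotp_def power2_eq_square)
        finally have "\<bar>u j i\<bar> \<le> 1" by (simp add: abs_square_le_1)
        moreover have "\<bar>chart n a 0 u t i\<bar> \<le> 1"
        proof -
          have "chart n a 0 u t i \<in> {-1/2..1/2}"
            using t i by (auto simp: C_def cube_def)
          then show ?thesis by auto
        qed
        ultimately show "\<bar>u j i * chart n a 0 u t i\<bar> \<le> 1"
          by (simp add: abs_mult mult_le_one)
      qed
      finally show ?thesis by simp
    qed
    then show "t \<in> PiE {1..n-1} (\<lambda>_. {- real n..real n})"
      using t by (force simp: C_def euclid_def PiE_iff abs_le_iff)
  qed
  have "emeasure ?N C \<le> emeasure ?N (PiE {1..n-1} (\<lambda>_. {- real n..real n}))"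
    by (rule emeasure_mono[OF box]) (intro sets_PiM_I_finite, auto)
  also have "\<dots> < \<infinity>"
    by (simp add: lborel_prod.emeasure_PiM power_less_top_ennreal)
  finally show "emeasure ?N C < \<infinity>" .
qed

text \<open>
  If \<open>\<bar>r\<bar> \<le> c\<close>, translating the section at height \<open>r\<close> by \<open>- r a\<close> moves every coordinate by
  at most \<open>c\<close>, so it fits into the central section dilated by \<open>1 + 2 c\<close>.
\<close>

lemma slab_le_central_section:
  assumes unit: "(\<Sum>j=1..n. (a j)\<^sup>2) = 1" and c: "0 \<le> c"
  shows "(\<integral>\<^sup>+y. indicator {-c..c} (\<Sum>k=1..n. a k * y k) \<partial>PiM {1..n} (\<lambda>_. unit_interval))
    \<le> ennreal (2 * c * (1 + 2 * c) ^ (n-1) * section_vol n a 0)"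
proof -
  obtain u where u: "orthonormal_basis n a u"
    and vol: "section_vol n a 0 = measure (lebesgue_PiM {1..n-1}) {t \<in> euclid (n-1). chart n a 0 u t \<in> cube n}"
    using section_vol_0_eq[OF unit] .
  let ?N = "lebesgue_PiM {1..n-1}" and ?M = "lebesgue_PiM {1..n}"
  define C where "C = {t \<in> euclid (n-1). chart n a 0 u t \<in> cube n}"
  have C[measurable]: "C \<in> sets ?N" and C_fin: "emeasure ?N C < \<infinity>"
    using emeasure_central_section_finite[OF u] by (simp_all add: C_def)
  have n: "n \<ge> 1"
    using unit by (cases n) auto
  then have I: "{1..n} = insert n {1..n-1}" and nn: "n \<notin> {1..n-1}" by auto
  have ua: "dotp n a (u j) = 0" if "j \<in> {1..n-1}" for j
    using u that by (auto simp: orthonormal_basis_def hyperplane_def)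
  have aa: "dotp n a a = 1"
    using unit by (simp add: dotp_def power2_eq_square)
  \<comment> \<open>Adding \<open>a\<close> as the last vector completes the basis of the hyperplane
    to one of the whole space, so the last parameter of \<open>L\<close> is the height along
    \<open>a\<close>.\<close>
  define v where "v j = (if j = n then a else u j)" for j
  have orth: "(\<Sum>i=1..n. v j i * v k i) = of_bool (j = k)" if jk: "j \<in> {1..n}" "k \<in> {1..n}" for j k
  proof -
    have "dotp n (v j) (v k) = of_bool (j = k)"
    proof -
      consider "j = n" "k = n" | "j = n" "k \<in> {1..n-1}" | "k = n" "j \<in> {1..n-1}"
        | "j \<in> {1..n-1}" "k \<in> {1..n-1}"
        using jk unfolding I by blast
      then show ?thesis
      proof cases
        case 1
        then show ?thesis by (simp add: v_def aa)
      next
        case 2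
        then have "k \<noteq> n" using nn by blast
        with 2 show ?thesis by (simp add: v_def ua)
      next
        case 3
        then have "j \<noteq> n" using nn by blast
        with 3 show ?thesis using ua[of j] by (simp add: v_def dotp_commute[of n "u j"])
      next
        case 4
        then have "j \<noteq> n" "k \<noteq> n" using nn by blast+
        with 4 show ?thesis using u by (simp add: v_def orthonormal_basis_def)
      qed
    qed
    then show ?thesis by (simp add: dotp_def)
  qed
  define L where "L t = (\<lambda>i\<in>{1..n}. \<Sum>j=1..n. t j * v j i)" for t :: "nat \<Rightarrow> real"
  have [measurable]: "L \<in> measurable ?M ?M"
    unfolding L_def by measurable
  have L_chart: "L (t(n := r)) = chart n a r u t" for t r
  proof -
    have "(\<Sum>j=1..n-1. (t(n := r)) j * v j i) = (\<Sum>j=1..n-1. t j * u j i)" for i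
      using nn by (intro sum.cong) (auto simp: v_def)
    then have "(\<Sum>j=1..n. (t(n := r)) j * v j i) = r * a i + (\<Sum>j=1..n-1. t j * u j i)" for i
      unfolding I using nn by (simp add: v_def)
    then show ?thesis by (simp add: L_def chart_def)
  qed
  define B where "B = {y \<in> space ?M. y \<in> cube n \<and> dotp n a y \<in> {-c..c}}"
  have [measurable]: "cube n \<in> sets ?M"
    unfolding cube_def by (intro sets_PiM_I_finite) auto
  have B[measurable]: "B \<in> sets ?M"
    unfolding B_def dotp_def by measurable
  have scaled: "indicator B (L (t(n := r))) \<le> (indicator {-c..c} r * indicator C (\<lambda>j\<in>{1..n-1}. 0 + 1 / (1 + 2 * c) * t j) :: ennreal)"
    if "t \<in> space ?N" for t r
  proof (cases "L (t(n := r)) \<in> B")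
    case True
    then have q: "chart n a r u t \<in> cube n" and "dotp n a (chart n a r u t) \<in> {-c..c}"
      by (simp_all add: L_chart B_def)
    then have r: "r \<in> {-c..c}"
      by (simp add: dotp_chart aa ua)
    let ?t = "\<lambda>j\<in>{1..n-1}. 0 + 1 / (1 + 2 * c) * t j"
    have "chart n a 0 u ?t i \<in> {-1/2..1/2}" if i: "i \<in> {1..n}" for i
    proof -
      have "chart n a 0 u ?t i = (\<Sum>j=1..n-1. ?t j * u j i)"
        using i by (simp add: chart_def)
      also have "\<dots> = (\<Sum>j=1..n-1. t j * u j i) / (1 + 2 * c)"
        unfolding sum_divide_distrib by (intro sum.cong) auto
      also have "(\<Sum>j=1..n-1. t j * u j i) = chart n a r u t i - r * a i"
        using i by (simp add: chart_def)
      finally have eq: "chart n a 0 u ?t i = (chart n a r u t i - r * a i) / (1 + 2 * c)" .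
      have "(a i)\<^sup>2 \<le> (\<Sum>i=1..n. (a i)\<^sup>2)"
        by (rule member_le_sum) (use i in auto)
      then have "\<bar>a i\<bar> \<le> 1" using unit by (simp add: abs_square_le_1)
      then have "\<bar>r * a i\<bar> \<le> c * 1"
        unfolding abs_mult using r by (intro mult_mono) auto
      moreover have "chart n a r u t i \<in> {-1/2..1/2}"
        using q i by (auto simp: cube_def)
      moreover have "\<bar>y - x\<bar> \<le> 1/2 * (1 + 2 * c)" if "\<bar>x\<bar> \<le> c * 1" "y \<in> {-1/2..1/2}" for x y :: real
        using that by (auto simp: abs_if field_simps split: if_splits)
      ultimately have "\<bar>chart n a r u t i - r * a i\<bar> \<le> 1/2 * (1 + 2 * c)"
        by blast
      then have "\<bar>chart n a 0 u ?t i\<bar> \<le> 1/2"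
        unfolding eq abs_divide using c by (simp add: divide_le_eq)
      then show ?thesis by (auto simp: abs_le_iff)
    qed
    then have "?t \<in> C"
      by (auto simp: C_def euclid_def cube_def PiE_iff chart_def)
    with r True show ?thesis by (simp add: indicator_def)
  qed simp
  have h: "(\<lambda>t. indicator C (\<lambda>j\<in>{1..n-1}. 0 + 1 / (1 + 2 * c) * t j) :: ennreal) \<in> borel_measurable ?N"
    by measurable
  have "(\<integral>\<^sup>+y. indicator {-c..c} (\<Sum>k=1..n. a k * y k) \<partial>PiM {1..n} (\<lambda>_. unit_interval))
      = (\<integral>\<^sup>+y. indicator (cube n) y * indicator {-c..c} (dotp n a y) \<partial>?M)"
    unfolding PiM_unit_interval_eq_density[OF finite_atLeastAtMost] cube_def[symmetric]
    unfolding dotp_def by (rule nn_integral_density) measurable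
  also have "\<dots> = (\<integral>\<^sup>+y. indicator B y \<partial>?M)"
    by (intro nn_integral_cong) (auto simp: B_def indicator_def)
  \<comment> \<open>Invariance under \<open>L\<close> rotates the slab so that its height becomes
    the last coordinate; Fubini then separates that coordinate from the section parameters.\<close>
  also have "\<dots> = (\<integral>\<^sup>+t. indicator B (L t) \<partial>?M)"
    unfolding L_def by (subst nn_integral_orthogonal_image[OF _ orth B]) (use B in auto)
  also have "\<dots> = (\<integral>\<^sup>+r. \<integral>\<^sup>+t. indicator B (L (t(n := r))) \<partial>?N \<partial>lborel)"
  proof -
    have "(\<lambda>t. indicator B (L t) :: ennreal) \<in> borel_measurable ?M" by measurable
    from lborel_prod.product_nn_integral_insert_rev[OF finite_atLeastAtMost nn this[unfolded I]]
    show ?thesis unfolding I .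
  qed
  also have "\<dots> \<le> (\<integral>\<^sup>+r. \<integral>\<^sup>+t. indicator {-c..c} r * indicator C (\<lambda>j\<in>{1..n-1}. 0 + 1 / (1 + 2 * c) * t j) \<partial>?N \<partial>lborel)"
    by (intro nn_integral_mono scaled)
  also have "\<dots> = (\<integral>\<^sup>+r. indicator {-c..c} r \<partial>lborel) * (\<integral>\<^sup>+t. indicator C (\<lambda>j\<in>{1..n-1}. 0 + 1 / (1 + 2 * c) * t j) \<partial>?N)"
    by (simp only: nn_integral_cmult[OF h]) (rule nn_integral_multc, measurable)
  also have "(\<integral>\<^sup>+t. indicator C (\<lambda>j\<in>{1..n-1}. 0 + 1 / (1 + 2 * c) * t j) \<partial>?N)
      = ennreal \<bar>1 + 2 * c\<bar> ^ card {1..n-1} * (\<integral>\<^sup>+t. indicator C (\<lambda>j\<in>{1..n-1}. 0 + 1 / (1 + 2 * c) * (\<lambda>j\<in>{1..n-1}. 0 + (1 + 2 * c) * t j) j) \<partial>?N)"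
    using c by (intro nn_integral_PiM_lborel_affine h) auto
  also have "(\<integral>\<^sup>+t. indicator C (\<lambda>j\<in>{1..n-1}. 0 + 1 / (1 + 2 * c) * (\<lambda>j\<in>{1..n-1}. 0 + (1 + 2 * c) * t j) j) \<partial>?N)
      = (\<integral>\<^sup>+t. indicator C t \<partial>?N)"
  proof (rule nn_integral_cong)
    fix t assume t: "t \<in> space ?N"
    have "(\<lambda>j\<in>{1..n-1}. 0 + 1 / (1 + 2 * c) * (\<lambda>j\<in>{1..n-1}. 0 + (1 + 2 * c) * t j) j) = restrict t {1..n-1}"
      using c by (intro restrict_ext) simp
    also have "\<dots> = t"
      using t by (simp add: space_PiM PiE_restrict)
    finally show "indicator C (\<lambda>j\<in>{1..n-1}. 0 + 1 / (1 + 2 * c) * (\<lambda>j\<in>{1..n-1}. 0 + (1 + 2 * c) * t j) j) = (indicator C t :: ennreal)"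
      by simp
  qed
  also have "(\<integral>\<^sup>+t. indicator C t \<partial>?N) = ennreal (section_vol n a 0)"
    unfolding vol C_def[symmetric] nn_integral_indicator[OF C]
    by (rule emeasure_eq_ennreal_measure) (use C_fin in simp)
  also have "(\<integral>\<^sup>+r. indicator {-c..c} r \<partial>lborel) * (ennreal \<bar>1 + 2 * c\<bar> ^ card {1..n-1} * ennreal (section_vol n a 0))
      = ennreal (2 * c * (1 + 2 * c) ^ (n-1) * section_vol n a 0)"
    using c by (simp add: ennreal_power ennreal_mult'[symmetric] mult.assoc del: ennreal_plus)
  finally show ?thesis .
qed

section \<open>The lower bound for the product\<close>

text \<open>\<open>cube_window_ge\<close> and \<open>slab_le_central_section\<close> bound the same
  slab probability from both sides. Dividing by 2 c and letting c tend to 0 removes the dilation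
  factor and exp (- s c^2/2).\<close>

lemma section_vol_ge:
  assumes unit: "(\<Sum>j=1..n. (a j)\<^sup>2) = 1" and a: "\<And>j. j \<in> {1..n} \<Longrightarrow> 0 \<le> a j" and s: "0 < s"
  shows "sqrt (2 * pi / s) * section_vol n a 0 \<ge>
    1 / sqrt (1 + s / 12) - 3 * s\<^sup>2 / 16 * (\<Sum>j=1..n. (a j) ^ 4)"
proof -
  define E where "E = (\<integral>y. exp (- (s * (\<Sum>k=1..n. a k * y k)\<^sup>2 / 2)) \<partial>PiM {1..n} (\<lambda>_. unit_interval))"
  have V: "0 \<le> section_vol n a 0"
    by (simp add: section_vol_def hyperplane_vol_def Let_def)
  have pos: "exp (- (s * c\<^sup>2 / 2)) * E \<le> sqrt (2 * pi / s) * ((1 + 2 * c) ^ (n-1) * section_vol n a 0)"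
    if c: "0 < c" for c :: real
  proof -
    have "ennreal (2 * c * exp (- (s * c\<^sup>2 / 2)) * E)
        \<le> ennreal (sqrt (2 * pi / s)) * (\<integral>\<^sup>+y. indicator {-c..c} (\<Sum>k=1..n. a k * y k) \<partial>PiM {1..n} (\<lambda>_. unit_interval))"
      unfolding E_def using c s a by (intro cube_window_ge) auto
    also have "\<dots> \<le> ennreal (sqrt (2 * pi / s)) * ennreal (2 * c * (1 + 2 * c) ^ (n-1) * section_vol n a 0)"
      using c by (intro mult_left_mono slab_le_central_section unit) auto
    also have "\<dots> = ennreal (sqrt (2 * pi / s) * (2 * c * (1 + 2 * c) ^ (n-1) * section_vol n a 0))"
      using s by (simp add: ennreal_mult')
    finally have "2 * c * exp (- (s * c\<^sup>2 / 2)) * E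
        \<le> sqrt (2 * pi / s) * (2 * c * (1 + 2 * c) ^ (n-1) * section_vol n a 0)"
      using c s V by (subst (asm) ennreal_le_iff) auto
    then have "2 * c * (exp (- (s * c\<^sup>2 / 2)) * E)
        \<le> 2 * c * (sqrt (2 * pi / s) * ((1 + 2 * c) ^ (n-1) * section_vol n a 0))"
      by (simp only: mult_ac)
    then show ?thesis
      using c by (subst (asm) mult_le_cancel_left_pos) auto
  qed
  have "((\<lambda>c. exp (- (s * c\<^sup>2 / 2)) * E) \<longlongrightarrow> exp (- (s * 0\<^sup>2 / 2)) * E) (at_right 0)"
    by (intro tendsto_intros) simp
  moreover have "((\<lambda>c. sqrt (2 * pi / s) * ((1 + 2 * c) ^ (n-1) * section_vol n a 0))
      \<longlongrightarrow> sqrt (2 * pi / s) * ((1 + 2 * 0) ^ (n-1) * section_vol n a 0)) (at_right (0::real))"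
    by (intro tendsto_intros)
  moreover have "\<forall>\<^sub>F c in at_right 0. exp (- (s * c\<^sup>2 / 2)) * E
      \<le> sqrt (2 * pi / s) * ((1 + 2 * c) ^ (n-1) * section_vol n a 0)"
    using eventually_at_right_less[of 0] by eventually_elim (rule pos)
  ultimately have "exp (- (s * 0\<^sup>2 / 2)) * E \<le> sqrt (2 * pi / s) * ((1 + 2 * 0) ^ (n-1) * section_vol n a 0)"
    by (intro tendsto_le[of "at_right 0"]) auto
  then have "E \<le> sqrt (2 * pi / s) * section_vol n a 0" by simp
  moreover have "1 / sqrt (1 + s / 12) - 3 * s\<^sup>2 / 16 * (\<Sum>j=1..n. (a j) ^ 4) \<le> E"
    unfolding E_def using s unit by (intro integral_gauss_cube_ge) auto
  ultimately show ?thesis by linarith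
qed

text \<open>Bounding two of the four factors by the largest entry gives at most a_n^2, which is
  below (c0 a_1)^2; the smallest square is at most the average 1/n.\<close>

lemma sum_pow4_le:
  assumes unit: "(\<Sum>j=1..n. (a j)\<^sup>2) = 1" and pos: "0 < a 1"
    and mono: "\<And>j k. j \<in> {1..n} \<Longrightarrow> k \<in> {1..n} \<Longrightarrow> j \<le> k \<Longrightarrow> a j \<le> a k"
    and ratio: "a n / a 1 < c0"
  shows "(\<Sum>j=1..n. (a j) ^ 4) \<le> c0\<^sup>2 / real n"
proof -
  have n: "n \<ge> 1"
    using unit by (cases n) auto
  have lo: "a 1 \<le> a j" and hi: "a j \<le> a n" if "j \<in> {1..n}" for j
    using that n by (auto intro!: mono)
  have "(a j) ^ 4 \<le> (a n)\<^sup>2 * (a j)\<^sup>2" if "j \<in> {1..n}" for j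
  proof -
    have "(a j)\<^sup>2 * (a j)\<^sup>2 \<le> (a n)\<^sup>2 * (a j)\<^sup>2"
      using lo[OF that] hi[OF that] pos by (intro mult_right_mono power_mono) auto
    then show ?thesis by (simp flip: power_add)
  qed
  then have "(\<Sum>j=1..n. (a j) ^ 4) \<le> (\<Sum>j=1..n. (a n)\<^sup>2 * (a j)\<^sup>2)"
    by (rule sum_mono)
  also have "\<dots> = (a n)\<^sup>2"
    by (simp only: sum_distrib_left[symmetric] unit mult_1_right)
  also have "\<dots> \<le> (c0 * a 1)\<^sup>2"
    using ratio pos lo[of n] n by (intro power_mono) (auto simp: divide_less_eq)
  also have "\<dots> \<le> c0\<^sup>2 * (1 / real n)"
  proof -
    have "(\<Sum>j=1..n. (a 1)\<^sup>2) \<le> (\<Sum>j=1..n. (a j)\<^sup>2)"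
      using lo pos by (intro sum_mono power_mono) auto
    then have "(a 1)\<^sup>2 \<le> 1 / real n"
      using n unit by (simp add: field_simps)
    then show ?thesis
      unfolding power_mult_distrib by (intro mult_left_mono) auto
  qed
  finally show ?thesis by simp
qed

theorem theorem1:
  "\<forall>c0::real. \<exists>N0::nat. N0 > 0 \<and>
     (\<forall>n\<ge>N0. \<forall>a::nat \<Rightarrow> real.
        (\<Sum>j=1..n. (a j)\<^sup>2) = 1 \<and>
        0 < a 1 \<and> (\<forall>j\<in>{1..n}. \<forall>k\<in>{1..n}. j \<le> k \<longrightarrow> a j \<le> a k) \<and>
        a n / a 1 < c0 \<longrightarrow>
        section_vol n a 0 * sign_sum_mean n a \<ge> 1)"
proof
  fix c0 :: real
  define I where "I T = integral {0..T} (\<lambda>t. exp (- (t\<^sup>2 / 2)))" for T :: real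
  \<comment> \<open>The limit of the section bound for s = 60: sqrt (s/(2 pi)) / sqrt (1 + s/12) =
    sqrt (30/pi) / sqrt 6.\<close>
  define \<beta> where "\<beta> = sqrt (5 / pi)"
  have \<beta>: "\<beta> > 0" by (simp add: \<beta>_def)
  \<comment> \<open>One term 1/T is the boundary loss of \<open>sign_sum_mean_ge\<close>; the other
    is its \<epsilon>, chosen as 1/T.\<close>
  have "((\<lambda>T. 2 / pi * (I T - 1 / T - 1 / T) * \<beta>) \<longlongrightarrow> 2 / pi * (sqrt (pi / 2) - 0 - 0) * \<beta>) at_top"
    unfolding I_def
    by (intro tendsto_intros tendsto_integral_gauss real_tendsto_divide_at_top[OF tendsto_const filterlim_ident])
  moreover have "1 < 2 / pi * (sqrt (pi / 2) - 0 - 0) * \<beta>"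
  proof -
    have "pi * pi < 3.15 * 3.15"
      using pi_approx by (intro mult_strict_mono) auto
    then have "1 < 10 / (pi * pi)" by simp
    also have "\<dots> = (2 / pi * (sqrt (pi / 2) - 0 - 0) * \<beta>)\<^sup>2"
      by (simp add: \<beta>_def power_mult_distrib power_divide power2_eq_square)
    finally have "1\<^sup>2 < (2 / pi * (sqrt (pi / 2) - 0 - 0) * \<beta>)\<^sup>2" by simp
    then show ?thesis
      by (rule power_less_imp_less_base) (use \<beta> in simp)
  qed
  ultimately have "\<forall>\<^sub>F T in at_top. 1 < 2 / pi * (I T - 1 / T - 1 / T) * \<beta>"
    by (rule order_tendstoD(1))
  \<comment> \<open>The condition \<open>1 \<le> T\<close> makes 1/T \<le> T, so this choice of
    \<epsilon> is admissible.\<close>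
  then have "\<forall>\<^sub>F T in at_top. 1 < 2 / pi * (I T - 1 / T - 1 / T) * \<beta> \<and> 1 \<le> T"
    using eventually_ge_at_top[of 1] by (rule eventually_conj)
  from eventually_happens'[OF trivial_limit_at_top_linorder this]
  obtain T where T: "1 < 2 / pi * (I T - 1 / T - 1 / T) * \<beta>" "1 \<le> T"
    by blast
  \<comment> \<open>With T now fixed, \<mu> and \<nu> are the two lower bounds as functions of the
    fourth power sum. Both decrease, so the bound c0^2/n for that sum may be inserted; 675 is 3 *
    60^2 / 16.\<close>
  define \<mu> where "\<mu> x = 2 / pi * (I T - 1 / T - 1 / T - T ^ 3 * x)" for x
  define \<nu> where "\<nu> x = sqrt (30 / pi) * (1 / sqrt 6 - 675 * x)" for x
  have \<nu>0: "\<nu> 0 = \<beta>"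
  proof -
    have "sqrt (5 / pi) = sqrt (30 / pi) / sqrt 6"
      by (subst real_sqrt_divide[symmetric]) simp
    then show ?thesis by (simp add: \<nu>_def \<beta>_def)
  qed
  have \<mu>\<beta>: "1 < \<mu> 0 * \<beta>"
    using T(1) by (simp only: \<mu>_def mult_zero_right diff_0_right)
  then have "0 < \<mu> 0 * \<beta>" by linarith
  then have \<mu>0: "\<mu> 0 > 0"
    using \<beta> by (simp add: zero_less_mult_iff)
  have x: "((\<lambda>n. c0\<^sup>2 / real n) \<longlongrightarrow> 0) sequentially"
    by (rule real_tendsto_divide_at_top[OF tendsto_const filterlim_real_sequentially])
  have \<mu>_lim: "((\<lambda>n. \<mu> (c0\<^sup>2 / real n)) \<longlongrightarrow> \<mu> 0) sequentially"
    unfolding \<mu>_def by (intro tendsto_intros x)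
  have \<nu>_lim: "((\<lambda>n. \<nu> (c0\<^sup>2 / real n)) \<longlongrightarrow> \<nu> 0) sequentially"
    unfolding \<nu>_def by (intro tendsto_intros x)
  have "\<forall>\<^sub>F n in sequentially. 1 < \<mu> (c0\<^sup>2 / real n) * \<nu> (c0\<^sup>2 / real n)"
    by (rule order_tendstoD(1)[OF tendsto_mult[OF \<mu>_lim \<nu>_lim]]) (simp add: \<nu>0 \<mu>\<beta>)
  moreover have "\<forall>\<^sub>F n in sequentially. 0 < \<mu> (c0\<^sup>2 / real n)"
    by (rule order_tendstoD(1)[OF \<mu>_lim \<mu>0])
  moreover have "\<forall>\<^sub>F n in sequentially. 0 < \<nu> (c0\<^sup>2 / real n)"
    by (rule order_tendstoD(1)[OF \<nu>_lim]) (simp add: \<nu>0 \<beta>)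
  moreover have "\<forall>\<^sub>F n in sequentially. 0 < (n :: nat)"
    by (rule eventually_gt_at_top)
  ultimately have "\<forall>\<^sub>F n in sequentially. 1 < \<mu> (c0\<^sup>2 / real n) * \<nu> (c0\<^sup>2 / real n)
      \<and> 0 < \<mu> (c0\<^sup>2 / real n) \<and> 0 < \<nu> (c0\<^sup>2 / real n) \<and> 0 < n"
    by eventually_elim simp
  then obtain N0 where N0: "\<And>n. n \<ge> N0 \<Longrightarrow> 1 < \<mu> (c0\<^sup>2 / real n) * \<nu> (c0\<^sup>2 / real n)
      \<and> 0 < \<mu> (c0\<^sup>2 / real n) \<and> 0 < \<nu> (c0\<^sup>2 / real n) \<and> 0 < n"
    by (auto simp: eventually_sequentially)
  have "1 \<le> section_vol n a 0 * sign_sum_mean n a"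
    if "n \<ge> N0" and unit: "(\<Sum>j=1..n. (a j)\<^sup>2) = 1" and pos: "0 < a 1"
      and mono: "\<forall>j\<in>{1..n}. \<forall>k\<in>{1..n}. j \<le> k \<longrightarrow> a j \<le> a k" and ratio: "a n / a 1 < c0" for n a
  proof -
    define S where "S = (\<Sum>j=1..n. (a j) ^ 4)"
    define x where "x = c0\<^sup>2 / real n"
    have S: "S \<le> x"
      unfolding S_def x_def by (rule sum_pow4_le[OF unit pos _ ratio]) (use mono in blast)
    have x: "1 < \<mu> x * \<nu> x" "0 < \<mu> x" "0 < \<nu> x"
      using N0[OF \<open>n \<ge> N0\<close>] by (simp_all add: x_def)
    have "\<mu> x \<le> \<mu> S"
      unfolding \<mu>_def using S T(2) by (intro mult_left_mono diff_left_mono) auto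
    also have "\<mu> S \<le> sign_sum_mean n a"
      unfolding \<mu>_def I_def S_def using T(2)
      by (intro sign_sum_mean_ge unit) (auto simp: divide_le_eq intro: order_trans[of 1])
    finally have M: "\<mu> x \<le> sign_sum_mean n a" .
    have nonneg: "0 \<le> a j" if "j \<in> {1..n}" for j
      using mono[rule_format, of 1 j] that pos by auto
    have "\<nu> x \<le> \<nu> S"
      unfolding \<nu>_def using S by (intro mult_left_mono diff_left_mono) auto
    also have "\<nu> S \<le> sqrt (30 / pi) * (sqrt (2 * pi / 60) * section_vol n a 0)"
      unfolding \<nu>_def S_def using section_vol_ge[OF unit nonneg, of 60]
      by (intro mult_left_mono) auto
    also have "sqrt (30 / pi) * (sqrt (2 * pi / 60) * section_vol n a 0) = section_vol n a 0"
    proof -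
      have "sqrt (30 / pi) * sqrt (2 * pi / 60) = 1"
        by (subst real_sqrt_mult[symmetric]) simp
      then show ?thesis by (simp only: mult.assoc[symmetric] mult_1_left)
    qed
    finally have V: "\<nu> x \<le> section_vol n a 0" .
    have "1 < \<nu> x * \<mu> x" using x by (simp add: mult.commute)
    also have "\<dots> \<le> section_vol n a 0 * sign_sum_mean n a"
      using V M x by (intro mult_mono) auto
    finally show ?thesis by simp
  qed
  \<comment> \<open>The condition 0 < n was included in the eventual properties so that taking n =
    N0 yields this.\<close>
  moreover have "N0 > 0" using N0[of N0] by simp
  ultimately show "\<exists>N0::nat. N0 > 0 \<and>
     (\<forall>n\<ge>N0. \<forall>a::nat \<Rightarrow> real.
        (\<Sum>j=1..n. (a j)\<^sup>2) = 1 \<and>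
        0 < a 1 \<and> (\<forall>j\<in>{1..n}. \<forall>k\<in>{1..n}. j \<le> k \<longrightarrow> a j \<le> a k) \<and>
        a n / a 1 < c0 \<longrightarrow>
        section_vol n a 0 * sign_sum_mean n a \<ge> 1)"
    by blast
qed

end
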